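(* Let $\mathcal{F}=\{f_i\}_{i\in I}$ be a $J$-frame for a Krein space $\mathcal{H}$. Then $\mathcal{F}$ is a tight $J$-frame for $\mathcal{H}$ if and only if $\mathcal{F}_+=\{f_i\}_{i\in I_+}$ is a tight frame for the Hilbert space $(\mathcal{M}_+,[\cdot,\cdot])$, $\mathcal{F}_-=\{f_i\}_{i\in I_-}$ is a tight frame for the Hilbert space $(\mathcal{M}_-,-[\cdot,\cdot])$, the frame bounds of $\mathcal{F}_+$ and $\mathcal{F}_-$ coincide, and $\mathcal{M}_-=\mathcal{M}_+^{[\perp]}$.
   Context: A (complex) Krein space is a vector space $\mathcal{H}$ with a hermitian sesquilinear form $[\cdot,\cdot]$ admitting a fundamental decomposition $\mathcal{H}=\mathcal{H}_+\dotplus\mathcal{H}_-$, direct and $[\cdot,\cdot]$-orthogonal, with $(\mathcal{H}_+,[\cdot,\cdot])$ and $(\mathcal{H}_-,-[\cdot,\cdot])$ Hilbert spaces. Fix one; the associated Hilbert inner product is $\langle x,y\rangle=[x_+,y_+]-[x_-,y_-]$, with norm $\|\cdot\|$ (the topology does not depend on the decomposition). For a subspace $\mathcal{S}$, $\mathcal{S}^{[\perp]}=\{x:[x,s]=0\ \forall s\in\mathcal{S}\}$. A subspace $\mathcal{S}$ is uniformly $J$-positive (resp. uniformly $J$-negative) if there is $\alpha>0$ with $[x,x]\ge\alpha\|x\|^2$ (resp. $-[x,x]\ge\alpha\|x\|^2$) for all $x\in\mathcal{S}$; it is maximal if it is maximal under inclusion among such subspaces. The adjoint $T^+$ of a bounded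 operator between Krein spaces is defined by $[Tx,y]=[x,T^+y]$. A Bessel family is $\mathcal{F}=\{f_i\}_{i\in I}\subset\mathcal{H}$ with $\sum_i|\langle f,f_i\rangle|^2\le\beta\|f\|^2$ for all $f\in\mathcal{H}$ and some $\beta>0$; its synthesis operator is the bounded operator $T:\ell_2(I)\to\mathcal{H}$, $Tx=\sum_{i\in I}x_if_i$. Put $I_+=\{i: [f_i,f_i]\ge0\}$, $I_-=\{i:[f_i,f_i]<0\}$; $P_\pm$ is the orthogonal projection of $\ell_2(I)$ onto $\ell_2(I_\pm)$, $T_\pm=TP_\pm$ and $\mathcal{M}_\pm=\overline{\operatorname{span}\{f_i:i\in I_\pm\}}$. The Bessel family $\mathcal{F}$ is a $J$-frame for $\mathcal{H}$ if the range $R(T_+)$ is a maximal uniformly $J$-positive subspace and $R(T_-)$ is a maximal uniformly $J$-negative subspace of $\mathcal{H}$ (then $R(T_\pm)=\mathcal{M}_\pm$). Given a $J$-frame, $\ell_2(I)$ is the Krein space with $[x,y]_2=\sum_{i\in I_+}x_i\overline{y_i}-\sum_{i\in I_-}x_i\overline{y_i}$, and $T^+$ is taken with respect to this form. The $J$-frame $\mathcal{F}$ is a tight $J$-frame if $TT^+=\alpha I$ for some $\alpha>0$. The family $\mathcal{F}_\pm$ is a tight frame for $(\mathcal{M}_\pm,\pm[\cdot,\cdot])$ with frame bound $\alpha_\pm>0$ if $\sum_{i\in I_\pm}|[f,f_i]|^2=\alpha_\pm(\pm[f,f])$ for every $f\in\mathcal{M}_\pm$; the frame bounds coincide when this holds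 with $\alpha_+=\alpha_-$. *)

theory Defs
  imports "HOL-Analysis.Analysis"
begin

text \<open>
  A complex vector space is the locale \<open>vector_space\<close> at scalar type \<open>complex\<close>; the space is
  the whole carrier type. Forms are linear in the first argument.
\<close>

text \<open>The distance of an inner product \<open>ip\<close> on a subspace. The absolute value makes the function
  nonnegative on the whole type, as the locale \<open>Metric_space\<close> demands, also where \<open>ip\<close> is not
  positive.\<close>

definition ip_dist :: "('a::ab_group_add \<Rightarrow> 'a \<Rightarrow> complex) \<Rightarrow> 'a \<Rightarrow> 'a \<Rightarrow> real" where
  "ip_dist ip x y = sqrt \<bar>Re (ip (x - y) (x - y))\<bar>"

text \<open>\<open>T\<^sup>+ y\<close> for \<open>T\<close> from the space \<open>X\<close> with form \<open>fX\<close> to a space with form \<open>fY\<close>: the unique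
  vector of \<open>X\<close> with \<open>fY (T x) y = fX x (T\<^sup>+ y)\<close> for all \<open>x\<close> in \<open>X\<close>.\<close>

definition krein_adjoint ::
  "'x set \<Rightarrow> ('x \<Rightarrow> 'x \<Rightarrow> complex) \<Rightarrow> ('y \<Rightarrow> 'y \<Rightarrow> complex) \<Rightarrow> ('x \<Rightarrow> 'y) \<Rightarrow> 'y \<Rightarrow> 'x" where
  "krein_adjoint X fX fY T y = (THE z. z \<in> X \<and> (\<forall>x\<in>X. fY (T x) y = fX x z))"

text \<open>Elements of \<open>\<ell>\<^sub>2(I)\<close> are functions on the index type that vanish off \<open>I\<close>.\<close>

definition ell2 :: "'i set \<Rightarrow> ('i \<Rightarrow> complex) set" where
  "ell2 I = {x. (\<forall>i. i \<notin> I \<longrightarrow> x i = 0) \<and> (\<lambda>i. (cmod (x i))\<^sup>2) summable_on I}"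

text \<open>For \<open>J \<subseteq> I\<close> this is the orthogonal projection of \<open>\<ell>\<^sub>2(I)\<close> onto \<open>\<ell>\<^sub>2(J)\<close>.\<close>

definition ell2_proj :: "'i set \<Rightarrow> ('i \<Rightarrow> complex) \<Rightarrow> 'i \<Rightarrow> complex" where
  "ell2_proj J x = (\<lambda>i. if i \<in> J then x i else 0)"

definition tight_frame_on ::
  "'a set \<Rightarrow> ('a \<Rightarrow> 'a \<Rightarrow> complex) \<Rightarrow> 'i set \<Rightarrow> ('i \<Rightarrow> 'a) \<Rightarrow> real \<Rightarrow> bool" where
  "tight_frame_on M ip J f \<alpha> \<longleftrightarrow>
     \<alpha> > 0 \<and> (\<forall>g\<in>M. ((\<lambda>i. (cmod (ip g (f i)))\<^sup>2) has_sum (\<alpha> * Re (ip g g))) J)"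

locale hermitian_space = vector_space scale
  for scale :: "complex \<Rightarrow> 'a::ab_group_add \<Rightarrow> 'a" (infixr \<open>*s\<close> 75) +
  fixes form :: "'a \<Rightarrow> 'a \<Rightarrow> complex"
  assumes form_add_left: "form (x + y) z = form x z + form y z"
    and form_scale_left: "form (c *s x) y = c * form x y"
    and form_hermitian: "form y x = cnj (form x y)"
begin

abbreviation neg_form :: "'a \<Rightarrow> 'a \<Rightarrow> complex" where
  "neg_form x y \<equiv> - form x y"

definition hilbert_subspace :: "'a set \<Rightarrow> ('a \<Rightarrow> 'a \<Rightarrow> complex) \<Rightarrow> bool" where
  "hilbert_subspace V ip \<longleftrightarrow>
     subspace V \<and> (\<forall>x\<in>V. x \<noteq> 0 \<longrightarrow> 0 < Re (ip x x)) \<and> Metric_space.mcomplete V (ip_dist ip)"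

definition fundamental_decomposition :: "'a set \<Rightarrow> 'a set \<Rightarrow> bool" where
  "fundamental_decomposition Hp Hm \<longleftrightarrow>
     subspace Hp \<and> subspace Hm \<and>
     Hp \<inter> Hm = {0} \<and> (\<forall>x. \<exists>p\<in>Hp. \<exists>m\<in>Hm. x = p + m) \<and>
     (\<forall>p\<in>Hp. \<forall>m\<in>Hm. form p m = 0) \<and>
     hilbert_subspace Hp form \<and> hilbert_subspace Hm neg_form"

definition orth_companion :: "'a set \<Rightarrow> 'a set" where
  "orth_companion S = {x. \<forall>s\<in>S. form x s = 0}"

end

locale krein_space = hermitian_space +
  assumes ex_fundamental_decomposition: "\<exists>Hp Hm. fundamental_decomposition Hp Hm"

locale decomposed_krein_space = krein_space scale form
  for scale :: "complex \<Rightarrow> 'a::ab_group_add \<Rightarrow> 'a" (infixr \<open>*s\<close> 75)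
    and form :: "'a \<Rightarrow> 'a \<Rightarrow> complex" +
  fixes Hp Hm :: "'a set"
  assumes decomposition: "fundamental_decomposition Hp Hm"
begin

definition pos_part :: "'a \<Rightarrow> 'a" where
  "pos_part x = (THE p. p \<in> Hp \<and> x - p \<in> Hm)"

definition neg_part :: "'a \<Rightarrow> 'a" where
  "neg_part x = (THE m. m \<in> Hm \<and> x - m \<in> Hp)"

definition hinner :: "'a \<Rightarrow> 'a \<Rightarrow> complex" where
  "hinner x y = form (pos_part x) (pos_part y) - form (neg_part x) (neg_part y)"

definition hnorm :: "'a \<Rightarrow> real" where
  "hnorm x = sqrt (Re (hinner x x))"

definition htopology :: "'a topology" where
  "htopology = Metric_space.mtopology UNIV (ip_dist hinner)"

definition unif_J_positive :: "'a set \<Rightarrow> bool" where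
  "unif_J_positive S \<longleftrightarrow>
     subspace S \<and> (\<exists>\<alpha>>0. \<forall>x\<in>S. Re (form x x) \<ge> \<alpha> * (hnorm x)\<^sup>2)"

definition unif_J_negative :: "'a set \<Rightarrow> bool" where
  "unif_J_negative S \<longleftrightarrow>
     subspace S \<and> (\<exists>\<alpha>>0. \<forall>x\<in>S. - Re (form x x) \<ge> \<alpha> * (hnorm x)\<^sup>2)"

definition max_unif_J_positive :: "'a set \<Rightarrow> bool" where
  "max_unif_J_positive S \<longleftrightarrow>
     unif_J_positive S \<and> (\<forall>S'. unif_J_positive S' \<and> S \<subseteq> S' \<longrightarrow> S' = S)"

definition max_unif_J_negative :: "'a set \<Rightarrow> bool" where
  "max_unif_J_negative S \<longleftrightarrow>
     unif_J_negative S \<and> (\<forall>S'. unif_J_negative S' \<and> S \<subseteq> S' \<longrightarrow> S' = S)"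

text \<open>The summability clause is needed because \<open>infsum\<close> is \<open>0\<close> for non-summable families.\<close>

definition bessel_family :: "'i set \<Rightarrow> ('i \<Rightarrow> 'a) \<Rightarrow> bool" where
  "bessel_family I f \<longleftrightarrow>
     (\<exists>\<beta>>0. \<forall>g. (\<lambda>i. (cmod (hinner g (f i)))\<^sup>2) summable_on I \<and>
                 (\<Sum>\<^sub>\<infinity>i\<in>I. (cmod (hinner g (f i)))\<^sup>2) \<le> \<beta> * (hnorm g)\<^sup>2)"

text \<open>The sum \<open>\<Sum>\<^sub>i x\<^sub>i f\<^sub>i\<close> is the norm limit of the net of finite partial sums; for a Bessel family
  it exists for every \<open>x\<close> in \<open>ell2 I\<close>.\<close>

definition synthesis :: "'i set \<Rightarrow> ('i \<Rightarrow> 'a) \<Rightarrow> ('i \<Rightarrow> complex) \<Rightarrow> 'a" where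
  "synthesis I f x =
     (THE y. limitin htopology (\<lambda>F. \<Sum>i\<in>F. x i *s f i) y (finite_subsets_at_top I))"

definition I_pos :: "'i set \<Rightarrow> ('i \<Rightarrow> 'a) \<Rightarrow> 'i set" where
  "I_pos I f = {i\<in>I. Re (form (f i) (f i)) \<ge> 0}"

definition I_neg :: "'i set \<Rightarrow> ('i \<Rightarrow> 'a) \<Rightarrow> 'i set" where
  "I_neg I f = {i\<in>I. Re (form (f i) (f i)) < 0}"

definition synthesis_pos :: "'i set \<Rightarrow> ('i \<Rightarrow> 'a) \<Rightarrow> ('i \<Rightarrow> complex) \<Rightarrow> 'a" where
  "synthesis_pos I f = synthesis I f \<circ> ell2_proj (I_pos I f)"

definition synthesis_neg :: "'i set \<Rightarrow> ('i \<Rightarrow> 'a) \<Rightarrow> ('i \<Rightarrow> complex) \<Rightarrow> 'a" where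
  "synthesis_neg I f = synthesis I f \<circ> ell2_proj (I_neg I f)"

definition M_pos :: "'i set \<Rightarrow> ('i \<Rightarrow> 'a) \<Rightarrow> 'a set" where
  "M_pos I f = htopology closure_of span (f ` I_pos I f)"

definition M_neg :: "'i set \<Rightarrow> ('i \<Rightarrow> 'a) \<Rightarrow> 'a set" where
  "M_neg I f = htopology closure_of span (f ` I_neg I f)"

definition J_frame :: "'i set \<Rightarrow> ('i \<Rightarrow> 'a) \<Rightarrow> bool" where
  "J_frame I f \<longleftrightarrow>
     bessel_family I f \<and>
     max_unif_J_positive (synthesis_pos I f ` ell2 I) \<and>
     max_unif_J_negative (synthesis_neg I f ` ell2 I)"

definition ell2_form ::
  "'i set \<Rightarrow> ('i \<Rightarrow> 'a) \<Rightarrow> ('i \<Rightarrow> complex) \<Rightarrow> ('i \<Rightarrow> complex) \<Rightarrow> complex" where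
  "ell2_form I f x y =
     (\<Sum>\<^sub>\<infinity>i\<in>I_pos I f. x i * cnj (y i)) - (\<Sum>\<^sub>\<infinity>i\<in>I_neg I f. x i * cnj (y i))"

definition synthesis_adjoint :: "'i set \<Rightarrow> ('i \<Rightarrow> 'a) \<Rightarrow> 'a \<Rightarrow> 'i \<Rightarrow> complex" where
  "synthesis_adjoint I f = krein_adjoint (ell2 I) (ell2_form I f) form (synthesis I f)"

definition tight_J_frame :: "'i set \<Rightarrow> ('i \<Rightarrow> 'a) \<Rightarrow> bool" where
  "tight_J_frame I f \<longleftrightarrow>
     J_frame I f \<and>
     (\<exists>\<alpha>::real. \<alpha> > 0 \<and> (\<forall>y. synthesis I f (synthesis_adjoint I f y) = of_real \<alpha> *s y))"

end

end

theory Submission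
  imports Defs
begin

text \<open>
  Write \<open>S\<^sub>J y = \<Sum>i\<in>J. [y, f\<^sub>i] f\<^sub>i\<close> and abbreviate \<open>P = S\<close> over \<open>I\<^sub>+\<close> and \<open>Q = - S\<close> over
  \<open>I\<^sub>-\<close>. The adjoint of the synthesis operator is \<open>(T\<^sup>+ y)\<^sub>i = \<plusminus> [y, f\<^sub>i]\<close> with the sign of the
  form on the \<open>i\<close>-th coordinate, so \<open>T T\<^sup>+ = P + Q\<close>. Both summands are selfadjoint for
  \<open>[\<cdot>,\<cdot>]\<close>, \<open>P\<close> has its values in \<open>M\<^sub>+\<close> and \<open>Q\<close> in \<open>M\<^sub>-\<close>, and since
  \<open>[P g, g] = \<Sum>i\<in>I\<^sub>+. |[g, f\<^sub>i]|\<^sup>2\<close>, the family over \<open>I\<^sub>+\<close> is tight with bound \<open>\<alpha>\<close> exactly if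
  \<open>[P g, g] = \<alpha> [g, g]\<close> on \<open>M\<^sub>+\<close>; likewise for \<open>Q\<close> on \<open>M\<^sub>-\<close>.

  The theorem is thereby reduced to algebra (\<open>sum_eq_scalar_iff_orthogonal\<close>). The form is positive
  definite on \<open>M\<^sub>+\<close> and negative definite on \<open>M\<^sub>-\<close>, so these subspaces meet only in \<open>0\<close>. If
  \<open>P + Q = \<alpha>\<close>, then \<open>P / \<alpha>\<close> is therefore the projection onto \<open>M\<^sub>+\<close> along \<open>M\<^sub>-\<close>; it is selfadjoint,
  hence its range and kernel are orthogonal, each being the companion of the other. Conversely, if
  \<open>M\<^sub>-\<close> is the companion of \<open>M\<^sub>+\<close>, a polarization argument turns the two tightness identities
  into \<open>P = \<alpha>\<close> on \<open>M\<^sub>+\<close> and \<open>Q = \<alpha>\<close> on \<open>M\<^sub>-\<close>. For any \<open>y\<close> the vector \<open>\<alpha> y - P y\<close> is then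
  orthogonal to \<open>M\<^sub>+\<close>, hence lies in \<open>M\<^sub>-\<close>, and testing against \<open>M\<^sub>-\<close> shows that it is \<open>Q y\<close>.

  Analysis is needed for two facts. The series defining \<open>T\<close> converges, by the Bessel bound and the
  completeness of the two components (\<open>bessel_series_converges\<close>, \<open>hilbert_complete\<close>). The
  closed span \<open>M\<^sub>\<plusminus>\<close> is the range of \<open>T\<^sub>\<plusminus>\<close>, because the closure of a uniformly definite subspace
  is uniformly definite and the range is maximal (\<open>M_pos_eq_synthesis_image\<close>,
  \<open>M_neg_eq_synthesis_image\<close>). Everything else about \<open>T\<close> follows from the weak description
  \<open>[T x, y] = \<Sum>i. x\<^sub>i [f\<^sub>i, y]\<close> (\<open>form_synthesis\<close>).
\<close>

section \<open>Selfadjoint operators on a hermitian space\<close>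

text \<open>\<open>*s\<close> is to denote only the scalar multiplication of the locales.\<close>

no_notation vector_scalar_mult (infixl \<open>*s\<close> 70)

context hermitian_space
begin

lemma form_zero_left [simp]: "form 0 y = 0"
  using form_add_left[of 0 0 y] by simp

lemma form_zero_right [simp]: "form x 0 = 0"
  using form_hermitian[of x 0] by simp

lemma form_add_right: "form x (y + z) = form x y + form x z"
  by (metis form_add_left form_hermitian complex_cnj_add)

lemma form_scale_right: "form x (c *s y) = cnj c * form x y"
  by (metis form_scale_left form_hermitian complex_cnj_mult)

lemma form_minus_left: "form (- x) y = - form x y"
  using form_add_left[of x "- x" y] by (simp add: add_eq_0_iff)

lemma form_minus_right: "form x (- y) = - form x y"
  using form_add_right[of x y "- y"] by (simp add: add_eq_0_iff)

lemma form_diff_left: "form (x - y) z = form x z - form y z"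
  using form_add_left[of x "- y" z] by (simp add: form_minus_left)

lemma form_diff_right: "form x (y - z) = form x y - form x z"
  using form_add_right[of x y "- z"] by (simp add: form_minus_right)

lemma form_sum_left: "form (sum g F) y = (\<Sum>i\<in>F. form (g i) y)"
  by (induction F rule: infinite_finite_induct) (simp_all add: form_add_left)

lemma form_self_real: "form x x = of_real (Re (form x x))"
  using arg_cong[OF form_hermitian[of x x], of Im] by (simp add: complex_eq_iff)

lemma cmod_form_commute: "cmod (form x y) = cmod (form y x)"
  by (metis form_hermitian complex_mod_cnj)

text \<open>The hermitian form \<open>B x y = [D x, y] - \<alpha> [x, y]\<close> vanishes on the diagonal of \<open>M\<close>, hence on all of
  \<open>M\<close> by polarization, and \<open>B x (D x - \<alpha> x)\<close> is the square of \<open>D x - \<alpha> x\<close>. Additivity of \<open>B\<close> in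
  the first argument comes from its additivity in the second and selfadjointness of \<open>D\<close>.\<close>

lemma selfadjoint_eq_scalar_on_definite_subspace:
  assumes "subspace M"
    and definite: "\<And>x. x \<in> M \<Longrightarrow> form x x = 0 \<Longrightarrow> x = 0"
    and maps: "\<And>x. x \<in> M \<Longrightarrow> D x \<in> M"
    and selfadjoint: "\<And>x y. x \<in> M \<Longrightarrow> y \<in> M \<Longrightarrow> form (D x) y = form x (D y)"
    and quadratic: "\<And>x. x \<in> M \<Longrightarrow> form (D x) x = complex_of_real \<alpha> * form x x"
    and "x \<in> M"
  shows "D x = of_real \<alpha> *s x"
proof -
  define B where "B x y = form (D x) y - of_real \<alpha> * form x y" for x y
  have add_right: "B x (y + z) = B x y + B x z" for x y z
    by (simp add: B_def form_add_right algebra_simps)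
  have herm: "B y x = cnj (B x y)" if "x \<in> M" "y \<in> M" for x y
    using selfadjoint[OF that(2,1)] form_hermitian[of x y] form_hermitian[of "D x" y]
    by (simp add: B_def)
  have add_left: "B (x + y) z = B x z + B y z" if "x \<in> M" "y \<in> M" "z \<in> M" for x y z
    using herm[OF that(3) subspace_add[OF \<open>subspace M\<close> that(1,2)]]
      herm[OF that(3,1)] herm[OF that(3,2)] by (simp add: add_right)
  have diag: "B x x = 0" if "x \<in> M" for x
    using quadratic[OF that] by (simp add: B_def)
  have Re0: "Re (B x y) = 0" if "x \<in> M" "y \<in> M" for x y
  proof -
    have "B (x + y) (x + y) = 0"
      using that by (intro diag subspace_add[OF \<open>subspace M\<close>])
    hence "B x y + B y x = 0"
      using that by (simp add: add_left add_right diag subspace_add[OF \<open>subspace M\<close>] add.commute)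
    thus ?thesis
      using arg_cong[OF herm[OF that], of Re] by (simp add: complex_eq_iff)
  qed
  have zero: "B x y = 0" if "x \<in> M" "y \<in> M" for x y
  proof -
    have "Re (B x (\<i> *s y)) = 0"
      using that by (intro Re0 subspace_scale[OF \<open>subspace M\<close>])
    moreover have "B x (\<i> *s y) = - \<i> * B x y"
      by (simp add: B_def form_scale_right algebra_simps)
    ultimately show ?thesis
      using Re0[OF that] by (simp add: complex_eq_iff)
  qed
  let ?d = "D x - of_real \<alpha> *s x"
  have mem: "?d \<in> M"
    using \<open>x \<in> M\<close> by (intro subspace_diff[OF \<open>subspace M\<close>] maps subspace_scale[OF \<open>subspace M\<close>])
  have "form ?d ?d = B x ?d"
    unfolding B_def form_diff_left form_scale_left ..
  also have "\<dots> = 0"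
    by (rule zero[OF \<open>x \<in> M\<close> mem])
  finally show ?thesis
    using definite[OF mem] by simp
qed

text \<open>The algebraic core. Left to right, \<open>P\<close> and \<open>Q\<close> are \<open>\<alpha>\<close> times the complementary projections for
  \<open>M\<close> and \<open>N\<close>, since \<open>M\<close> and \<open>N\<close> meet only in \<open>0\<close>; orthogonality of \<open>M\<close> and \<open>N\<close> is then
  selfadjointness of \<open>P\<close>. Right to left, tightness gives \<open>P\<close> and \<open>Q\<close> on \<open>M\<close> and \<open>N\<close>, and these
  values determine both on the whole space through selfadjointness.\<close>

lemma sum_eq_scalar_iff_orthogonal:
  fixes \<alpha> :: real
  assumes "\<alpha> \<noteq> 0" and M: "subspace M" and N: "subspace N"
    and pos: "\<And>x. x \<in> M \<Longrightarrow> x \<noteq> 0 \<Longrightarrow> 0 < Re (form x x)"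
    and neg: "\<And>x. x \<in> N \<Longrightarrow> x \<noteq> 0 \<Longrightarrow> Re (form x x) < 0"
    and P: "\<And>y. P y \<in> M" and Q: "\<And>y. Q y \<in> N"
    and P_selfadjoint: "\<And>x y. form (P x) y = form x (P y)"
    and Q_selfadjoint: "\<And>x y. form (Q x) y = form x (Q y)"
  shows "(\<forall>y. P y + Q y = of_real \<alpha> *s y) \<longleftrightarrow>
    (\<forall>g\<in>M. form (P g) g = of_real \<alpha> * form g g) \<and>
    (\<forall>g\<in>N. form (Q g) g = of_real \<alpha> * form g g) \<and> N = orth_companion M"
    (is "?L \<longleftrightarrow> ?R")
proof
  assume L: ?L
  have disjoint: "x = 0" if "x \<in> M" "x \<in> N" for x
    using pos[OF that(1)] neg[OF that(2)] by (cases "x = 0") auto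
  have on_M: "P y = of_real \<alpha> *s y \<and> Q y = 0" if "y \<in> M" for y
  proof -
    have "Q y = of_real \<alpha> *s y - P y"
      using L[rule_format, of y] by (simp add: algebra_simps)
    hence "Q y \<in> M"
      using that P by (simp add: subspace_diff[OF M] subspace_scale[OF M])
    hence "Q y = 0"
      using disjoint Q by blast
    thus ?thesis
      using L[rule_format, of y] by simp
  qed
  have on_N: "Q y = of_real \<alpha> *s y \<and> P y = 0" if "y \<in> N" for y
  proof -
    have "P y = of_real \<alpha> *s y - Q y"
      using L[rule_format, of y] by (simp add: algebra_simps)
    hence "P y \<in> N"
      using that Q by (simp add: subspace_diff[OF N] subspace_scale[OF N])
    hence "P y = 0"
      using disjoint P by blast
    thus ?thesis
      using L[rule_format, of y] by simp
  qed
  have orth: "form s r = 0" if "r \<in> M" "s \<in> N" for r s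
  proof -
    have "of_real \<alpha> * form s r = form s (P r)"
      using on_M[OF that(1)] by (simp add: form_scale_right)
    also have "\<dots> = 0"
      using on_N[OF that(2)] by (simp flip: P_selfadjoint)
    finally show ?thesis
      using \<open>\<alpha> \<noteq> 0\<close> by simp
  qed
  have "y \<in> N" if "y \<in> orth_companion M" for y
  proof -
    have "form (P y) (P y) = of_real \<alpha> * form y (P y) - form (Q y) (P y)"
      using arg_cong[OF L[rule_format, of y], of "\<lambda>v. form v (P y)"]
      by (simp add: form_add_left form_scale_left algebra_simps)
    also have "\<dots> = 0"
      using that orth P Q by (simp add: orth_companion_def)
    finally have "P y = 0"
      using pos[OF P[of y]] by (cases "P y = 0") auto
    hence "of_real \<alpha> *s y \<in> N"
      using L[rule_format, of y] Q[of y] by simp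
    hence "of_real (1 / \<alpha>) *s of_real \<alpha> *s y \<in> N"
      by (rule subspace_scale[OF N])
    thus ?thesis
      using \<open>\<alpha> \<noteq> 0\<close> by simp
  qed
  with orth have "N = orth_companion M"
    by (auto simp: orth_companion_def)
  thus ?R
    using on_M on_N by (simp add: form_scale_left)
next
  assume R: ?R
  have orth: "form s r = 0" if "r \<in> M" "s \<in> N" for r s
    using R that by (auto simp: orth_companion_def)
  hence orth': "form r s = 0" if "r \<in> M" "s \<in> N" for r s
    using that form_hermitian[of r s] by simp
  have P_on_M: "P g = of_real \<alpha> *s g" if "g \<in> M" for g
  proof (rule selfadjoint_eq_scalar_on_definite_subspace[OF M _ P P_selfadjoint _ that])
    show "x = 0" if "x \<in> M" "form x x = 0" for x
      using pos[OF that(1)] that(2) by (cases "x = 0") auto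
  qed (use R in blast)
  have Q_on_N: "Q g = of_real \<alpha> *s g" if "g \<in> N" for g
  proof (rule selfadjoint_eq_scalar_on_definite_subspace[OF N _ Q Q_selfadjoint _ that])
    show "x = 0" if "x \<in> N" "form x x = 0" for x
      using neg[OF that(1)] that(2) by (cases "x = 0") auto
  qed (use R in blast)
  show ?L
  proof
    fix y
    define v where "v = of_real \<alpha> *s y - P y"
    have "form v g = 0" if "g \<in> M" for g
      using P_on_M[OF that]
      by (simp add: v_def form_diff_left form_scale_left form_scale_right P_selfadjoint)
    hence v: "v \<in> N"
      using R by (simp add: orth_companion_def)
    \<comment> \<open>\<open>v\<close> and \<open>Q y\<close> both lie in \<open>N\<close>, so it suffices that they have the same pairings with \<open>N\<close>.\<close>
    have "form (Q y) z = form v z" if "z \<in> N" for z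
      using Q_on_N[OF that] orth'[OF P that]
      by (simp add: v_def Q_selfadjoint form_diff_left form_scale_left form_scale_right)
    hence "form (Q y - v) (Q y - v) = 0"
      using subspace_diff[OF N Q v] by (simp add: form_diff_left)
    hence "Q y = v"
      using neg[OF subspace_diff[OF N Q v], of y] by (cases "Q y - v = 0") auto
    thus "P y + Q y = of_real \<alpha> *s y"
      by (simp add: v_def)
  qed
qed

end

section \<open>Spaces with a positive definite form\<close>

text \<open>Completeness speaks of sequences, while unordered sums are limits of nets. A Cauchy net over
  finite sets is controlled by the countably many sets \<open>E n\<close> beyond which it varies by less than
  \<open>1 / (n + 1)\<close>; the limit along the increasing unions of these sets is the limit of the net.\<close>

lemma (in Metric_space) mcomplete_imp_Cauchy_net_converges:
  assumes "mcomplete" and s: "\<And>F. s F \<in> M"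
    and Cauchy: "\<And>\<epsilon>. \<epsilon> > 0 \<Longrightarrow>
      \<exists>F. finite F \<and> F \<subseteq> I \<and> (\<forall>G. finite G \<and> F \<subseteq> G \<and> G \<subseteq> I \<longrightarrow> d (s F) (s G) < \<epsilon>)"
  shows "\<exists>y. limitin mtopology s y (finite_subsets_at_top I)"
proof -
  have "\<exists>F. finite F \<and> F \<subseteq> I \<and>
      (\<forall>G. finite G \<and> F \<subseteq> G \<and> G \<subseteq> I \<longrightarrow> d (s F) (s G) < inverse (real (Suc n)))" for n
    by (rule Cauchy) simp
  then obtain E where fin: "\<And>n. finite (E n)" and sub: "\<And>n. E n \<subseteq> I"
    and E: "\<And>n G. finite G \<Longrightarrow> E n \<subseteq> G \<Longrightarrow> G \<subseteq> I \<Longrightarrow> d (s (E n)) (s G) < inverse (real (Suc n))"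
    by metis
  define C where "C n = (\<Union>k\<le>n. E k)" for n
  have C: "finite (C n)" "C n \<subseteq> I" "m \<le> n \<Longrightarrow> E m \<subseteq> C n" for m n
    using fin sub by (auto simp: C_def)
  have "MCauchy (s \<circ> C)"
    unfolding MCauchy_def
  proof (intro conjI allI impI)
    show "range (s \<circ> C) \<subseteq> M"
      using s by auto
    fix \<epsilon> :: real assume "\<epsilon> > 0"
    then obtain N where N: "inverse (real (Suc N)) < \<epsilon> / 2"
      using reals_Archimedean half_gt_zero by blast
    have "d ((s \<circ> C) m) ((s \<circ> C) n) < \<epsilon>" if "N \<le> m" "N \<le> n" for m n
    proof -
      have "d (s (C m)) (s (C n)) \<le> d (s (E N)) (s (C m)) + d (s (E N)) (s (C n))"
        using s triangle'' by blast
      also have "\<dots> < \<epsilon>"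
        using E[of "C m" N] E[of "C n" N] C that N by force
      finally show ?thesis by simp
    qed
    thus "\<exists>N. \<forall>m n. N \<le> m \<longrightarrow> N \<le> n \<longrightarrow> d ((s \<circ> C) m) ((s \<circ> C) n) < \<epsilon>"
      by blast
  qed
  then obtain y where y: "limitin mtopology (s \<circ> C) y sequentially"
    using \<open>mcomplete\<close> by (auto simp: mcomplete_def)
  have "y \<in> M"
    using y by (simp add: limitin_metric)
  have "limitin mtopology s y (finite_subsets_at_top I)"
    unfolding limitin_metric
  proof (intro conjI allI impI)
    show "y \<in> M" by fact
    fix \<epsilon> :: real assume "\<epsilon> > 0"
    then obtain N where N: "inverse (real (Suc N)) < \<epsilon> / 3"
      using reals_Archimedean[of "\<epsilon> / 3"] by auto
    have "\<forall>\<^sub>F n in sequentially. (s \<circ> C) n \<in> M \<and> d ((s \<circ> C) n) y < \<epsilon> / 3"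
      using y \<open>\<epsilon> > 0\<close> unfolding limitin_metric by (meson divide_pos_pos zero_less_numeral)
    then obtain K where "\<And>n. K \<le> n \<Longrightarrow> d (s (C n)) y < \<epsilon> / 3"
      by (auto simp: eventually_sequentially)
    then obtain n where n: "N \<le> n" "d (s (C n)) y < \<epsilon> / 3"
      using max.cobounded1 max.cobounded2 by meson
    have "d (s G) y < \<epsilon>" if "finite G" "E N \<subseteq> G" "G \<subseteq> I" for G
    proof -
      have "d (s G) y \<le> d (s (E N)) (s G) + d (s (E N)) y"
        using s \<open>y \<in> M\<close> triangle'' by blast
      also have "d (s (E N)) y \<le> d (s (E N)) (s (C n)) + d (s (C n)) y"
        using s \<open>y \<in> M\<close> triangle by blast
      finally show ?thesis
        using E[OF that] E[OF C(1,3,2), of N n] n N by simp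
    qed
    thus "\<forall>\<^sub>F F in finite_subsets_at_top I. s F \<in> M \<and> d (s F) y < \<epsilon>"
      unfolding eventually_finite_subsets_at_top
      using fin[of N] sub[of N] s by (intro exI[of _ "E N"]) simp
  qed
  thus ?thesis ..
qed

locale inner_product_space = hermitian_space scale ip
  for scale :: "complex \<Rightarrow> 'a::ab_group_add \<Rightarrow> 'a" (infixr \<open>*s\<close> 75)
    and ip :: "'a \<Rightarrow> 'a \<Rightarrow> complex" +
  assumes ip_positive: "x \<noteq> 0 \<Longrightarrow> 0 < Re (ip x x)"
begin

definition ip_norm :: "'a \<Rightarrow> real" where
  "ip_norm x = sqrt (Re (ip x x))"

lemma ip_nonneg: "0 \<le> Re (ip x x)"
  using ip_positive[of x] by (cases "x = 0") auto

lemma ip_norm_nonneg [simp]: "0 \<le> ip_norm x"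
  by (simp add: ip_norm_def ip_nonneg)

lemma ip_norm_square: "(ip_norm x)\<^sup>2 = Re (ip x x)"
  by (simp add: ip_norm_def ip_nonneg)

lemma ip_norm_eq_0_iff [simp]: "ip_norm x = 0 \<longleftrightarrow> x = 0"
  using ip_positive[of x] by (cases "x = 0") (auto simp: ip_norm_def)

lemma ip_norm_scale: "ip_norm (c *s x) = cmod c * ip_norm x"
proof -
  have "ip (c *s x) (c *s x) = (c * cnj c) * ip x x"
    by (simp add: form_scale_left form_scale_right)
  also have "\<dots> = of_real ((cmod c)\<^sup>2) * ip x x"
    by (simp only: complex_norm_square)
  finally have "Re (ip (c *s x) (c *s x)) = (cmod c)\<^sup>2 * Re (ip x x)"
    by (simp only: Re_complex_of_real Im_complex_of_real times_complex.sel)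
  thus ?thesis
    by (simp add: ip_norm_def real_sqrt_mult)
qed

lemma ip_norm_minus: "ip_norm (- x) = ip_norm x"
  by (simp add: ip_norm_def form_minus_left form_minus_right)

lemma ip_Cauchy_Schwarz: "cmod (ip x y) \<le> ip_norm x * ip_norm y"
proof (cases "y = 0")
  case False
  define r where "r = Re (ip y y)"
  have r: "ip y y = of_real r" "r > 0"
    using form_self_real ip_positive False by (auto simp: r_def)
  \<comment> \<open>\<open>t y\<close> is the orthogonal projection of \<open>x\<close> onto the line through \<open>y\<close>.\<close>
  define t where "t = ip x y / of_real r"
  have yx: "ip y x = cnj (ip x y)"
    by (rule form_hermitian)
  have "ip (x - t *s y) (x - t *s y) = ip x x - of_real ((cmod (ip x y))\<^sup>2 / r)"
    using r by (simp add: form_diff_left form_diff_right form_scale_left form_scale_right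
        t_def yx complex_norm_square field_simps flip: of_real_power)
  hence "(cmod (ip x y))\<^sup>2 / r \<le> Re (ip x x)"
    using ip_nonneg[of "x - t *s y"] by simp
  hence "(cmod (ip x y))\<^sup>2 \<le> (ip_norm x * ip_norm y)\<^sup>2"
    using r by (simp add: ip_norm_square power_mult_distrib field_simps)
  thus ?thesis
    by (rule power2_le_imp_le) simp
qed simp

lemma ip_norm_triangle: "ip_norm (x + y) \<le> ip_norm x + ip_norm y"
proof -
  have "Re (ip x y) \<le> ip_norm x * ip_norm y"
    using complex_Re_le_cmod ip_Cauchy_Schwarz order_trans by blast
  moreover have "Re (ip y x) = Re (ip x y)"
    using form_hermitian[of x y] by simp
  ultimately have "(ip_norm (x + y))\<^sup>2 \<le> (ip_norm x + ip_norm y)\<^sup>2"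
    by (simp add: ip_norm_square power2_sum form_add_left form_add_right)
  thus ?thesis
    by (rule power2_le_imp_le) simp
qed

lemma ip_dist_eq: "ip_dist ip x y = ip_norm (x - y)"
  by (simp add: ip_dist_def ip_norm_def ip_nonneg)

sublocale metric: Metric_space UNIV "ip_dist ip"
proof
  show "0 \<le> ip_dist ip x y" for x y
    by (simp add: ip_dist_eq)
  show "ip_dist ip x y = ip_dist ip y x" for x y
    using ip_norm_minus[of "x - y"] by (simp add: ip_dist_eq)
  show "ip_dist ip x y = 0 \<longleftrightarrow> x = y" for x y
    by (simp add: ip_dist_eq)
  show "ip_dist ip x z \<le> ip_dist ip x y + ip_dist ip y z" for x y z
    using ip_norm_triangle[of "x - y" "y - z"] by (simp add: ip_dist_eq)
qed

lemma limitin_iff_ip_norm: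
  "limitin metric.mtopology s y F \<longleftrightarrow> ((\<lambda>a. ip_norm (s a - y)) \<longlongrightarrow> 0) F"
  by (simp add: metric.limitin_metric_dist_null ip_dist_eq)

text \<open>By Cauchy-Schwarz, convergence in norm implies weak convergence.\<close>

lemma tendsto_ip:
  assumes "limitin metric.mtopology s y F"
  shows "((\<lambda>a. ip (s a) h) \<longlongrightarrow> ip y h) F"
proof -
  have "((\<lambda>a. ip_norm (s a - y) * ip_norm h) \<longlongrightarrow> 0) F"
    using assms by (intro tendsto_mult_left_zero) (simp add: limitin_iff_ip_norm)
  moreover have "\<forall>\<^sub>F a in F. norm (ip (s a) h - ip y h) \<le> ip_norm (s a - y) * ip_norm h"
    by (simp add: ip_Cauchy_Schwarz flip: form_diff_left)
  ultimately have "((\<lambda>a. ip (s a) h - ip y h) \<longlongrightarrow> 0) F"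
    by (rule Lim_null_comparison[rotated])
  thus ?thesis
    by (simp add: LIM_zero_iff)
qed

lemma closure_of_iff_ip_norm:
  "x \<in> metric.mtopology closure_of S \<longleftrightarrow> (\<forall>r>0. \<exists>y\<in>S. ip_norm (y - x) < r)"
  by (simp add: metric.metric_closure_of metric.commute[of x] flip: ip_dist_eq)

definition bessel_bound :: "'i set \<Rightarrow> ('i \<Rightarrow> 'a) \<Rightarrow> real \<Rightarrow> bool" where
  "bessel_bound I f \<beta> \<longleftrightarrow> (\<forall>g. (\<lambda>i. (cmod (ip g (f i)))\<^sup>2) summable_on I \<and>
     (\<Sum>\<^sub>\<infinity>i\<in>I. (cmod (ip g (f i)))\<^sup>2) \<le> \<beta> * (ip_norm g)\<^sup>2)"

text \<open>The synthesis operator is the adjoint of the analysis operator and so satisfies the same bound: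
  for \<open>v = \<Sum>i\<in>G. x\<^sub>i f\<^sub>i\<close> expand one factor of \<open>\<langle>v, v\<rangle>\<close> and apply Cauchy-Schwarz for sums; the
  factor \<open>(\<Sum>i\<in>G. |\<langle>v, f\<^sub>i\<rangle>|\<^sup>2)\<^sup>1\<^sup>/\<^sup>2\<close> is at most \<open>\<surd>\<beta> \<parallel>v\<parallel>\<close>.\<close>

lemma bessel_bound_finite_combination:
  assumes "bessel_bound I f \<beta>" "0 \<le> \<beta>" "finite G" "G \<subseteq> I"
  shows "ip_norm (\<Sum>i\<in>G. x i *s f i) \<le> sqrt \<beta> * L2_set (\<lambda>i. cmod (x i)) G"
proof -
  let ?L = "L2_set (\<lambda>i. cmod (x i)) G"
  define v where "v = (\<Sum>i\<in>G. x i *s f i)"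
  have "(\<Sum>i\<in>G. (cmod (ip v (f i)))\<^sup>2) \<le> \<beta> * (ip_norm v)\<^sup>2"
    using assms(1) finite_sum_le_infsum[OF _ assms(3,4), of "\<lambda>i. (cmod (ip v (f i)))\<^sup>2"]
    unfolding bessel_bound_def by (meson order_trans zero_le_power2)
  hence "L2_set (\<lambda>i. cmod (ip v (f i))) G \<le> sqrt (\<beta> * (ip_norm v)\<^sup>2)"
    unfolding L2_set_def by (rule real_sqrt_le_mono)
  hence L2_coeff: "L2_set (\<lambda>i. cmod (ip v (f i))) G \<le> sqrt \<beta> * ip_norm v"
    by (simp add: real_sqrt_mult)
  have "ip v v = (\<Sum>i\<in>G. x i * ip (f i) v)"
    by (subst (1) v_def) (simp add: form_sum_left form_scale_left)
  hence "(ip_norm v)\<^sup>2 \<le> cmod (\<Sum>i\<in>G. x i * ip (f i) v)"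
    by (metis ip_norm_square complex_Re_le_cmod)
  also have "\<dots> \<le> (\<Sum>i\<in>G. \<bar>cmod (x i)\<bar> * \<bar>cmod (ip v (f i))\<bar>)"
    by (intro order_trans[OF norm_sum] sum_mono) (simp add: norm_mult cmod_form_commute[of v])
  also have "\<dots> \<le> ?L * L2_set (\<lambda>i. cmod (ip v (f i))) G"
    by (rule L2_set_mult_ineq)
  also have "\<dots> \<le> ?L * (sqrt \<beta> * ip_norm v)"
    using L2_coeff by (intro mult_left_mono) (simp_all add: L2_set_nonneg)
  finally have "ip_norm v * ip_norm v \<le> sqrt \<beta> * ?L * ip_norm v"
    by (simp add: power2_eq_square mult_ac)
  moreover have "0 \<le> sqrt \<beta> * ?L"
    using \<open>0 \<le> \<beta>\<close> by (simp add: L2_set_nonneg)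
  ultimately show ?thesis
    by (cases "v = 0") (simp_all add: v_def[symmetric] ip_norm_eq_0_iff[THEN iffD2]
        mult_le_cancel_right less_le[of 0 "ip_norm v"])
qed

text \<open>The partial sums form a Cauchy net, because the previous bound applies to the part of the
  series outside a finite set and the tails of \<open>\<Sum>i. |x\<^sub>i|\<^sup>2\<close> are small.\<close>

lemma bessel_series_converges:
  assumes complete: "metric.mcomplete" and bessel: "bessel_bound I f \<beta>" "0 \<le> \<beta>"
    and x: "(\<lambda>i. (cmod (x i))\<^sup>2) summable_on I"
  shows "\<exists>y. limitin metric.mtopology (\<lambda>F. \<Sum>i\<in>F. x i *s f i) y (finite_subsets_at_top I)"
proof (rule metric.mcomplete_imp_Cauchy_net_converges[OF complete])
  define S where "S = (\<Sum>\<^sub>\<infinity>i\<in>I. (cmod (x i))\<^sup>2)"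
  fix \<epsilon> :: real assume "\<epsilon> > 0"
  \<comment> \<open>The denominator is \<open>\<beta> + 1\<close> because \<open>\<beta>\<close> may be \<open>0\<close>.\<close>
  define \<delta> where "\<delta> = \<epsilon>\<^sup>2 / (\<beta> + 1)"
  have "\<delta> > 0"
    using \<open>\<epsilon> > 0\<close> \<open>0 \<le> \<beta>\<close> by (simp add: \<delta>_def)
  have S: "((\<lambda>i. (cmod (x i))\<^sup>2) has_sum S) I"
    unfolding S_def using x by simp
  obtain F where F: "finite F" "F \<subseteq> I" "S - (\<Sum>i\<in>F. (cmod (x i))\<^sup>2) \<le> \<delta> / 2"
  proof -
    obtain F where "finite F" "F \<subseteq> I" "dist (\<Sum>i\<in>F. (cmod (x i))\<^sup>2) S \<le> \<delta> / 2"
      using has_sum_finite_approximation[OF S, of "\<delta> / 2"] \<open>\<delta> > 0\<close> by auto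
    moreover from this have "S - (\<Sum>i\<in>F. (cmod (x i))\<^sup>2) \<le> \<delta> / 2"
      unfolding dist_real_def by linarith
    ultimately show ?thesis
      using that by blast
  qed
  have "ip_dist ip (\<Sum>i\<in>F. x i *s f i) (\<Sum>i\<in>G. x i *s f i) < \<epsilon>"
    if "finite G" "F \<subseteq> G" "G \<subseteq> I" for G
  proof -
    have "(\<Sum>i\<in>G. (cmod (x i))\<^sup>2) \<le> S"
      using finite_sum_le_has_sum[OF S that(1,3)] by simp
    hence tail: "(\<Sum>i\<in>G - F. (cmod (x i))\<^sup>2) \<le> \<delta> / 2"
      using F(3) by (simp add: sum_diff that)
    have "ip_dist ip (\<Sum>i\<in>F. x i *s f i) (\<Sum>i\<in>G. x i *s f i) = ip_norm (\<Sum>i\<in>G - F. x i *s f i)"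
      unfolding metric.commute[of "\<Sum>i\<in>F. x i *s f i"] by (simp add: ip_dist_eq sum_diff that)
    also have "\<dots> \<le> sqrt \<beta> * L2_set (\<lambda>i. cmod (x i)) (G - F)"
      using that by (intro bessel_bound_finite_combination[OF bessel]) auto
    also have "\<dots> = sqrt (\<beta> * (\<Sum>i\<in>G - F. (cmod (x i))\<^sup>2))"
      by (simp add: L2_set_def real_sqrt_mult)
    also have "\<dots> \<le> sqrt (\<beta> * (\<delta> / 2))"
      using tail \<open>0 \<le> \<beta>\<close> by (intro real_sqrt_le_mono mult_left_mono)
    also have "\<dots> < \<epsilon>"
    proof (rule real_less_lsqrt)
      have "\<beta> * (\<delta> / 2) = \<epsilon>\<^sup>2 * (\<beta> / (\<beta> + 1) / 2)"
        by (simp add: \<delta>_def)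
      also have "\<dots> < \<epsilon>\<^sup>2 * 1"
        using \<open>0 \<le> \<beta>\<close> \<open>\<epsilon> > 0\<close> by (intro mult_strict_left_mono) (simp_all add: field_simps)
      finally show "\<beta> * (\<delta> / 2) < \<epsilon>\<^sup>2" by simp
    qed (use \<open>\<epsilon> > 0\<close> in simp)
    finally show ?thesis .
  qed
  thus "\<exists>F. finite F \<and> F \<subseteq> I \<and> (\<forall>G. finite G \<and> F \<subseteq> G \<and> G \<subseteq> I \<longrightarrow>
      ip_dist ip (\<Sum>i\<in>F. x i *s f i) (\<Sum>i\<in>G. x i *s f i) < \<epsilon>)"
    using F by blast
qed simp

lemma limitin_add:
  assumes "limitin metric.mtopology s y F" "limitin metric.mtopology t z F"
  shows "limitin metric.mtopology (\<lambda>a. s a + t a) (y + z) F"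
proof -
  have "((\<lambda>a. ip_norm (s a - y) + ip_norm (t a - z)) \<longlongrightarrow> 0 + 0) F"
    using assms unfolding limitin_iff_ip_norm by (rule tendsto_add)
  moreover have "norm (ip_norm (s a + t a - (y + z))) \<le> ip_norm (s a - y) + ip_norm (t a - z)" for a
    using ip_norm_triangle[of "s a - y" "t a - z"] by (simp add: add_diff_add)
  ultimately show ?thesis
    unfolding limitin_iff_ip_norm by (auto intro: Lim_null_comparison[OF always_eventually, rotated])
qed

lemma limitin_scale:
  assumes "limitin metric.mtopology s y F"
  shows "limitin metric.mtopology (\<lambda>a. c *s s a) (c *s y) F"
  using assms tendsto_mult_right_zero[of "\<lambda>a. ip_norm (s a - y)" F "cmod c"]
  by (simp add: limitin_iff_ip_norm ip_norm_scale flip: scale_right_diff_distrib)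

lemma limitin_minus:
  assumes "limitin metric.mtopology s y F"
  shows "limitin metric.mtopology (\<lambda>a. - s a) (- y) F"
  using limitin_scale[OF assms, of "- 1"] by simp

lemma tendsto_ip_norm:
  assumes "limitin metric.mtopology s y F"
  shows "((\<lambda>a. ip_norm (s a)) \<longlongrightarrow> ip_norm y) F"
proof -
  have "\<bar>ip_norm x - ip_norm z\<bar> \<le> ip_norm (x - z)" for x z
    using ip_norm_triangle[of "x - z" z] ip_norm_triangle[of "z - x" x] ip_norm_minus[of "x - z"]
    by simp
  hence "((\<lambda>a. ip_norm (s a) - ip_norm y) \<longlongrightarrow> 0) F"
    using assms by (simp add: Lim_null_comparison[where g = "\<lambda>a. ip_norm (s a - y)"] limitin_iff_ip_norm)
  thus ?thesis
    by (simp add: LIM_zero_iff)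
qed

lemma closure_of_sequentially:
  assumes "x \<in> metric.mtopology closure_of S"
  obtains s where "\<And>n. s n \<in> S" "limitin metric.mtopology s x sequentially"
proof -
  have "\<exists>y\<in>S. ip_norm (y - x) < inverse (real (Suc n))" for n
    using assms by (simp add: closure_of_iff_ip_norm)
  then obtain s where s: "\<And>n. s n \<in> S" "\<And>n. ip_norm (s n - x) < inverse (real (Suc n))"
    by metis
  have "(\<lambda>n. ip_norm (s n - x)) \<longlonglongrightarrow> 0"
    by (rule Lim_null_comparison[OF _ LIMSEQ_inverse_real_of_nat])
      (use s(2) in \<open>intro always_eventually allI; simp add: less_imp_le\<close>)
  thus ?thesis
    using that[OF s(1)] by (simp add: limitin_iff_ip_norm)
qed

lemma limitin_imp_closure_of:
  assumes "limitin metric.mtopology s x F" "\<And>a. s a \<in> S" "F \<noteq> bot"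
  shows "x \<in> metric.mtopology closure_of S"
proof -
  have "\<exists>y\<in>S. ip_norm (y - x) < r" if "r > 0" for r
  proof -
    have "\<forall>\<^sub>F a in F. ip_norm (s a - x) < r"
      using assms(1) that unfolding limitin_iff_ip_norm by (simp add: order_tendsto_iff)
    thus ?thesis
      using assms(2,3) eventually_happens' by blast
  qed
  thus ?thesis
    by (simp add: closure_of_iff_ip_norm)
qed

lemma subspace_closure_of:
  assumes "subspace S"
  shows "subspace (metric.mtopology closure_of S)"
proof (rule subspaceI)
  show "0 \<in> metric.mtopology closure_of S"
    using closure_of_subset[of S metric.mtopology] subspace_0[OF assms] by auto
next
  fix x y assume "x \<in> metric.mtopology closure_of S" "y \<in> metric.mtopology closure_of S"
  then obtain s t where "\<And>n. s n \<in> S" "limitin metric.mtopology s x sequentially"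
    "\<And>n. t n \<in> S" "limitin metric.mtopology t y sequentially"
    by (meson closure_of_sequentially)
  thus "x + y \<in> metric.mtopology closure_of S"
    by (intro limitin_imp_closure_of[OF limitin_add]) (auto intro: subspace_add[OF assms])
next
  fix c x assume "x \<in> metric.mtopology closure_of S"
  then obtain s where "\<And>n. s n \<in> S" "limitin metric.mtopology s x sequentially"
    by (meson closure_of_sequentially)
  thus "c *s x \<in> metric.mtopology closure_of S"
    by (intro limitin_imp_closure_of[OF limitin_scale]) (auto intro: subspace_scale[OF assms])
qed

text \<open>Transfers completeness of a subset with a distance of its own, which may be arbitrary off the
  subset. This serves the components of a Krein space, whose distances come from \<open>\<plusminus>[\<cdot>,\<cdot>]\<close>
  and not from the Hilbert inner product.\<close>

lemma Cauchy_sequence_in_complete_subset: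
  assumes commute: "\<And>x y. ip_dist b x y = ip_dist b y x"
    and agree: "\<And>x y. x \<in> V \<Longrightarrow> y \<in> V \<Longrightarrow> ip_dist b x y = ip_dist ip x y"
    and complete: "Metric_space.mcomplete V (ip_dist b)"
    and \<sigma>: "\<And>n. \<sigma> n \<in> V" "metric.MCauchy \<sigma>"
  obtains x where "limitin metric.mtopology \<sigma> x sequentially"
proof -
  interpret V: Metric_space V "ip_dist b"
  proof
    show "0 \<le> ip_dist b x y" for x y
      by (simp add: ip_dist_def)
    show "ip_dist b x y = ip_dist b y x" for x y
      by (rule commute)
    show "ip_dist b x y = 0 \<longleftrightarrow> x = y" if "x \<in> V" "y \<in> V" for x y
      using that by (simp add: agree)
    show "ip_dist b x z \<le> ip_dist b x y + ip_dist b y z" if "x \<in> V" "y \<in> V" "z \<in> V" for x y z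
      using that metric.triangle[of x y z] by (simp add: agree)
  qed
  have "V.MCauchy \<sigma>"
    using \<sigma> by (auto simp: V.MCauchy_def metric.MCauchy_def agree)
  then obtain x where x: "limitin V.mtopology \<sigma> x sequentially"
    using complete by (auto simp: V.mcomplete_def)
  hence "x \<in> V"
    by (simp add: V.limitin_metric)
  hence "limitin metric.mtopology \<sigma> x sequentially"
    using x \<sigma>(1) by (simp add: V.limitin_metric_dist_null metric.limitin_metric_dist_null agree)
  thus ?thesis
    by (rule that)
qed

end

section \<open>The Hilbert space structure of a Krein space\<close>

context decomposed_krein_space
begin

lemma
  shows subspace_Hp: "subspace Hp" and subspace_Hm: "subspace Hm"
    and Hp_Hm_disjoint: "Hp \<inter> Hm = {0}"
    and Hp_Hm_span: "\<exists>p\<in>Hp. \<exists>m\<in>Hm. x = p + m"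
    and form_Hp_Hm: "p \<in> Hp \<Longrightarrow> m \<in> Hm \<Longrightarrow> form p m = 0"
    and hilbert_Hp: "hilbert_subspace Hp form"
    and hilbert_Hm: "hilbert_subspace Hm neg_form"
  using decomposition by (simp_all add: fundamental_decomposition_def)

lemma form_Hm_Hp: "m \<in> Hm \<Longrightarrow> p \<in> Hp \<Longrightarrow> form m p = 0"
  using form_Hp_Hm[of p m] form_hermitian[of p m] by simp

lemma decomposition_unique:
  assumes "p \<in> Hp" "m \<in> Hm" "q \<in> Hp" "n \<in> Hm" "p + m = q + n"
  shows "p = q \<and> m = n"
proof -
  have "p - q = n - m"
    using assms(5) by (simp add: algebra_simps)
  moreover have "p - q \<in> Hp" "n - m \<in> Hm"
    using assms by (simp_all add: subspace_diff[OF subspace_Hp] subspace_diff[OF subspace_Hm])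
  ultimately have "p - q \<in> Hp \<inter> Hm"
    by simp
  hence "p = q"
    using Hp_Hm_disjoint by simp
  thus ?thesis
    using assms(5) by simp
qed

lemma pos_part_add_eq: "pos_part (p + m) = p" if "p \<in> Hp" "m \<in> Hm"
  unfolding pos_part_def
proof (rule the_equality)
  show "p \<in> Hp \<and> p + m - p \<in> Hm"
    using that by simp
  show "q = p" if "q \<in> Hp \<and> p + m - q \<in> Hm" for q
    using decomposition_unique[THEN conjunct1, of q "p + m - q" p m] that \<open>p \<in> Hp\<close> \<open>m \<in> Hm\<close> by simp
qed

lemma neg_part_add_eq: "neg_part (p + m) = m" if "p \<in> Hp" "m \<in> Hm"
  unfolding neg_part_def
proof (rule the_equality)
  show "m \<in> Hm \<and> p + m - m \<in> Hp"
    using that by simp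
  show "n = m" if "n \<in> Hm \<and> p + m - n \<in> Hp" for n
    using decomposition_unique[THEN conjunct2, of "p + m - n" n p m] that \<open>p \<in> Hp\<close> \<open>m \<in> Hm\<close> by simp
qed

lemma
  shows pos_part_in_Hp [simp]: "pos_part x \<in> Hp"
    and neg_part_in_Hm [simp]: "neg_part x \<in> Hm"
    and parts_sum: "pos_part x + neg_part x = x"
  using Hp_Hm_span[of x] by (auto simp: pos_part_add_eq neg_part_add_eq)

lemma
  shows pos_part_add: "pos_part (x + y) = pos_part x + pos_part y"
    and neg_part_add: "neg_part (x + y) = neg_part x + neg_part y"
proof -
  have "(pos_part x + neg_part x) + (pos_part y + neg_part y)
      = (pos_part x + pos_part y) + (neg_part x + neg_part y)"
    by (simp only: add_ac)
  hence eq: "x + y = (pos_part x + pos_part y) + (neg_part x + neg_part y)"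
    by (simp only: parts_sum)
  have "pos_part x + pos_part y \<in> Hp" "neg_part x + neg_part y \<in> Hm"
    by (simp_all add: subspace_add[OF subspace_Hp] subspace_add[OF subspace_Hm])
  thus "pos_part (x + y) = pos_part x + pos_part y"
    "neg_part (x + y) = neg_part x + neg_part y"
    unfolding eq by (rule pos_part_add_eq, rule neg_part_add_eq)
qed

lemma
  shows pos_part_scale: "pos_part (c *s x) = c *s pos_part x"
    and neg_part_scale: "neg_part (c *s x) = c *s neg_part x"
proof -
  have eq: "c *s x = c *s pos_part x + c *s neg_part x"
    by (simp only: parts_sum flip: scale_right_distrib)
  have "c *s pos_part x \<in> Hp" "c *s neg_part x \<in> Hm"
    by (simp_all add: subspace_scale[OF subspace_Hp] subspace_scale[OF subspace_Hm])
  thus "pos_part (c *s x) = c *s pos_part x" "neg_part (c *s x) = c *s neg_part x"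
    unfolding eq by (rule pos_part_add_eq, rule neg_part_add_eq)
qed

lemma form_Hp_positive: "x \<in> Hp \<Longrightarrow> x \<noteq> 0 \<Longrightarrow> 0 < Re (form x x)"
  using hilbert_Hp by (simp add: hilbert_subspace_def)

lemma form_Hm_negative: "x \<in> Hm \<Longrightarrow> x \<noteq> 0 \<Longrightarrow> Re (form x x) < 0"
  using hilbert_Hm by (simp add: hilbert_subspace_def)

sublocale hilbert: inner_product_space scale hinner
proof
  show "hinner (x + y) z = hinner x z + hinner y z" for x y z
    by (simp add: hinner_def pos_part_add neg_part_add form_add_left)
  show "hinner (c *s x) y = c * hinner x y" for c x y
    by (simp add: hinner_def pos_part_scale neg_part_scale form_scale_left algebra_simps)
  show "hinner y x = cnj (hinner x y)" for x y
    using form_hermitian[of "pos_part x" "pos_part y"] form_hermitian[of "neg_part x" "neg_part y"]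
    by (simp add: hinner_def)
  show "0 < Re (hinner x x)" if "x \<noteq> 0" for x
  proof -
    have "0 \<le> Re (form (pos_part x) (pos_part x))"
      using form_Hp_positive[of "pos_part x"] by (cases "pos_part x = 0") auto
    moreover have "Re (form (neg_part x) (neg_part x)) \<le> 0"
      using form_Hm_negative[of "neg_part x"] by (cases "neg_part x = 0") auto
    moreover have "pos_part x \<noteq> 0 \<or> neg_part x \<noteq> 0"
      using that parts_sum[of x] by auto
    ultimately show ?thesis
      using form_Hp_positive[of "pos_part x"] form_Hm_negative[of "neg_part x"]
      by (force simp: hinner_def)
  qed
qed

lemma hnorm_eq: "hnorm = hilbert.ip_norm"
  by (simp add: fun_eq_iff hnorm_def hilbert.ip_norm_def)

lemma htopology_eq: "htopology = hilbert.metric.mtopology"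
  by (simp add: htopology_def)

text \<open>The operator usually called \<open>J\<close>. It is a norm isometry with \<open>[x, y] = \<langle>x, J y\<rangle>\<close>, which
  transfers Cauchy-Schwarz, continuity and the Bessel bound from \<open>\<langle>\<cdot>,\<cdot>\<rangle>\<close> to \<open>[\<cdot>,\<cdot>]\<close>.\<close>

definition fundamental_symmetry :: "'a \<Rightarrow> 'a" where
  "fundamental_symmetry x = pos_part x - neg_part x"

lemma
  shows pos_part_fundamental_symmetry: "pos_part (fundamental_symmetry x) = pos_part x"
    and neg_part_fundamental_symmetry: "neg_part (fundamental_symmetry x) = - neg_part x"
  using pos_part_add_eq[of "pos_part x" "- neg_part x"] neg_part_add_eq[of "pos_part x" "- neg_part x"]
  by (simp_all add: fundamental_symmetry_def subspace_neg[OF subspace_Hm])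

lemma form_eq_hinner_fundamental_symmetry: "form x y = hinner x (fundamental_symmetry y)"
proof -
  have "form x y = form (pos_part x + neg_part x) (pos_part y + neg_part y)"
    by (simp add: parts_sum)
  thus ?thesis
    by (simp add: hinner_def pos_part_fundamental_symmetry neg_part_fundamental_symmetry
        form_add_left form_add_right form_minus_right form_Hp_Hm form_Hm_Hp)
qed

lemma hnorm_fundamental_symmetry: "hnorm (fundamental_symmetry x) = hnorm x"
  by (simp add: hnorm_def hinner_def pos_part_fundamental_symmetry neg_part_fundamental_symmetry
      form_minus_left form_minus_right)

lemma cmod_form_le: "cmod (form x y) \<le> hnorm x * hnorm y"
  using hilbert.ip_Cauchy_Schwarz[of x "fundamental_symmetry y"]
  by (simp add: form_eq_hinner_fundamental_symmetry hnorm_fundamental_symmetry flip: hnorm_eq)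

lemma tendsto_form:
  "limitin htopology s y F \<Longrightarrow> ((\<lambda>a. form (s a) h) \<longlongrightarrow> form y h) F"
  using hilbert.tendsto_ip[of s y F "fundamental_symmetry h"]
  by (simp add: htopology_eq flip: form_eq_hinner_fundamental_symmetry)

text \<open>Uses \<open>[s, s] - [y, y] = [s - y, s] + [y, s - y]\<close>; the first term tends to \<open>0\<close> because
  \<open>s\<close> stays bounded in norm, the second by weak convergence.\<close>

lemma tendsto_form_self:
  assumes "limitin htopology s y F"
  shows "((\<lambda>a. form (s a) (s a)) \<longlongrightarrow> form y y) F"
proof -
  have dist: "((\<lambda>a. hnorm (s a - y)) \<longlongrightarrow> 0) F"
    using assms by (simp add: htopology_eq hnorm_eq hilbert.limitin_iff_ip_norm)
  have norm: "((\<lambda>a. hnorm (s a)) \<longlongrightarrow> hnorm y) F"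
    using assms by (simp add: htopology_eq hnorm_eq hilbert.tendsto_ip_norm)
  have "((\<lambda>a. form (s a - y) (s a)) \<longlongrightarrow> 0) F"
  proof (rule Lim_null_comparison)
    show "\<forall>\<^sub>F a in F. norm (form (s a - y) (s a)) \<le> hnorm (s a - y) * hnorm (s a)"
      by (simp add: cmod_form_le)
    show "((\<lambda>a. hnorm (s a - y) * hnorm (s a)) \<longlongrightarrow> 0) F"
      using tendsto_mult[OF dist norm] by simp
  qed
  moreover have "((\<lambda>a. form y (s a)) \<longlongrightarrow> form y y) F"
    using tendsto_cnj[OF tendsto_form[OF assms, of y]] by (simp flip: form_hermitian)
  ultimately have "((\<lambda>a. form (s a - y) (s a) + form y (s a)) \<longlongrightarrow> 0 + form y y) F"
    by (rule tendsto_add)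
  thus ?thesis
    by (simp add: form_diff_left)
qed

lemma pos_part_of_Hp: "pos_part x = x" and neg_part_of_Hp: "neg_part x = 0" if "x \<in> Hp"
  using pos_part_add_eq[OF that subspace_0[OF subspace_Hm]]
    neg_part_add_eq[OF that subspace_0[OF subspace_Hm]] by simp_all

lemma pos_part_of_Hm: "pos_part x = 0" and neg_part_of_Hm: "neg_part x = x" if "x \<in> Hm"
  using pos_part_add_eq[OF subspace_0[OF subspace_Hp] that]
    neg_part_add_eq[OF subspace_0[OF subspace_Hp] that] by simp_all

lemma hinner_on_Hp: "x \<in> Hp \<Longrightarrow> hinner x x = form x x"
  by (simp add: hinner_def pos_part_of_Hp neg_part_of_Hp)

lemma hinner_on_Hm: "x \<in> Hm \<Longrightarrow> hinner x x = - form x x"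
  by (simp add: hinner_def pos_part_of_Hm neg_part_of_Hm)

lemma hinner_self_parts:
  "hinner x x = hinner (pos_part x) (pos_part x) + hinner (neg_part x) (neg_part x)"
  by (simp add: hinner_on_Hp hinner_on_Hm) (simp add: hinner_def)

lemma pos_part_diff: "pos_part (x - y) = pos_part x - pos_part y"
  and neg_part_diff: "neg_part (x - y) = neg_part x - neg_part y"
  using pos_part_add[of "x - y" y] neg_part_add[of "x - y" y] by simp_all

text \<open>The components of a Cauchy sequence are Cauchy, since \<open>\<parallel>x\<parallel>\<^sup>2 = \<parallel>x\<^sub>+\<parallel>\<^sup>2 + \<parallel>x\<^sub>-\<parallel>\<^sup>2\<close>. They converge
  in \<open>Hp\<close> and \<open>Hm\<close>, and the limits add up to a limit of the sequence.\<close>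

lemma hilbert_complete: "hilbert.metric.mcomplete"
  unfolding hilbert.metric.mcomplete_def
proof (intro allI impI)
  fix \<sigma> assume \<sigma>: "hilbert.metric.MCauchy \<sigma>"
  have dist_pos: "ip_dist hinner (pos_part x) (pos_part y) \<le> ip_dist hinner x y" for x y
    using hinner_self_parts[of "x - y"] hilbert.ip_nonneg[of "neg_part (x - y)"]
    by (simp add: hilbert.ip_dist_eq hilbert.ip_norm_def flip: pos_part_diff)
  have dist_neg: "ip_dist hinner (neg_part x) (neg_part y) \<le> ip_dist hinner x y" for x y
    using hinner_self_parts[of "x - y"] hilbert.ip_nonneg[of "pos_part (x - y)"]
    by (simp add: hilbert.ip_dist_eq hilbert.ip_norm_def flip: neg_part_diff)
  obtain p where p: "limitin hilbert.metric.mtopology (\<lambda>n. pos_part (\<sigma> n)) p sequentially"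
  proof (rule hilbert.Cauchy_sequence_in_complete_subset[of form Hp])
    show "ip_dist form x y = ip_dist form y x" for x y
      using form_minus_left[of "x - y" "x - y"] form_minus_right[of "y - x" "x - y"]
      by (simp add: ip_dist_def)
    show "ip_dist form x y = ip_dist hinner x y" if "x \<in> Hp" "y \<in> Hp" for x y
      using that by (simp add: ip_dist_def hinner_on_Hp subspace_diff[OF subspace_Hp])
    show "Metric_space.mcomplete Hp (ip_dist form)"
      using hilbert_Hp by (simp add: hilbert_subspace_def)
    show "hilbert.metric.MCauchy (\<lambda>n. pos_part (\<sigma> n))"
      using \<sigma> dist_pos unfolding hilbert.metric.MCauchy_def by (meson order_le_less_trans subset_UNIV)
  qed auto
  obtain m where m: "limitin hilbert.metric.mtopology (\<lambda>n. neg_part (\<sigma> n)) m sequentially"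
  proof (rule hilbert.Cauchy_sequence_in_complete_subset[of neg_form Hm])
    show "ip_dist neg_form x y = ip_dist neg_form y x" for x y
      using form_minus_left[of "x - y" "x - y"] form_minus_right[of "y - x" "x - y"]
      by (simp add: ip_dist_def)
    show "ip_dist neg_form x y = ip_dist hinner x y" if "x \<in> Hm" "y \<in> Hm" for x y
      using that by (simp add: ip_dist_def hinner_on_Hm subspace_diff[OF subspace_Hm])
    show "Metric_space.mcomplete Hm (ip_dist neg_form)"
      using hilbert_Hm by (simp add: hilbert_subspace_def)
    show "hilbert.metric.MCauchy (\<lambda>n. neg_part (\<sigma> n))"
      using \<sigma> dist_neg unfolding hilbert.metric.MCauchy_def by (meson order_le_less_trans subset_UNIV)
  qed auto
  show "\<exists>x. limitin hilbert.metric.mtopology \<sigma> x sequentially"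
    using hilbert.limitin_add[OF p m] by (auto simp: parts_sum)
qed

end

section \<open>Synthesis operator of a Bessel family\<close>

lemma has_sum_if_mem_iff:
  assumes "J \<subseteq> I"
  shows "((\<lambda>i. if i \<in> J then g i else 0) has_sum S) I \<longleftrightarrow> (g has_sum S) J"
  by (rule has_sum_cong_neutral) (use assms in auto)

lemma summable_on_if_mem_iff:
  "J \<subseteq> I \<Longrightarrow> (\<lambda>i. if i \<in> J then g i else 0) summable_on I \<longleftrightarrow> g summable_on J"
  by (simp add: summable_on_def has_sum_if_mem_iff)

lemma ell2_proj_in_ell2:
  assumes "x \<in> ell2 I" "J \<subseteq> I"
  shows "ell2_proj J x \<in> ell2 I"
proof -
  have "(\<lambda>i. if i \<in> J then (cmod (x i))\<^sup>2 else 0) summable_on I"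
    using assms summable_on_subset_banach[of "\<lambda>i. (cmod (x i))\<^sup>2" I J]
    by (simp add: ell2_def summable_on_if_mem_iff)
  moreover have "(\<lambda>i. (cmod (ell2_proj J x i))\<^sup>2) = (\<lambda>i. if i \<in> J then (cmod (x i))\<^sup>2 else 0)"
    by (auto simp: ell2_proj_def)
  ultimately show ?thesis
    using assms by (auto simp: ell2_def ell2_proj_def)
qed

locale bessel_family_in_krein_space = decomposed_krein_space scale form Hp Hm
  for scale :: "complex \<Rightarrow> 'a::ab_group_add \<Rightarrow> 'a" (infixr \<open>*s\<close> 75)
    and form :: "'a \<Rightarrow> 'a \<Rightarrow> complex" and Hp Hm :: "'a set" +
  fixes I :: "'i set" and f :: "'i \<Rightarrow> 'a"
  assumes bessel: "bessel_family I f"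
begin

abbreviation T :: "('i \<Rightarrow> complex) \<Rightarrow> 'a" where
  "T \<equiv> synthesis I f"

lemma synthesis_eqI:
  assumes "limitin htopology (\<lambda>F. \<Sum>i\<in>F. x i *s f i) y (finite_subsets_at_top I)"
  shows "T x = y"
  unfolding synthesis_def
  using assms by (intro the_equality)
    (auto simp: htopology_eq intro: hilbert.metric.limitin_metric_unique)

lemma synthesis_limit:
  assumes "x \<in> ell2 I"
  shows "limitin htopology (\<lambda>F. \<Sum>i\<in>F. x i *s f i) (T x) (finite_subsets_at_top I)"
proof -
  obtain \<beta> where "\<beta> > 0" "hilbert.bessel_bound I f \<beta>"
    using bessel by (auto simp: bessel_family_def hilbert.bessel_bound_def hnorm_eq)
  then obtain y where "limitin htopology (\<lambda>F. \<Sum>i\<in>F. x i *s f i) y (finite_subsets_at_top I)"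
    using hilbert.bessel_series_converges[OF hilbert_complete, of I f \<beta> x] assms
    by (auto simp: ell2_def htopology_eq)
  with synthesis_eqI[OF this] show ?thesis
    by simp
qed

text \<open>The norm limit defining \<open>T x\<close> enters the remaining proofs mostly through this weak form, which
  reduces them to series of complex numbers.\<close>

lemma form_synthesis:
  assumes "x \<in> ell2 I"
  shows "((\<lambda>i. x i * form (f i) y) has_sum form (T x) y) I"
  using tendsto_form[OF synthesis_limit[OF assms], of y]
  by (simp add: has_sum_def form_sum_left form_scale_left)

lemma synthesis_unit:
  assumes "i \<in> I"
  shows "T (\<lambda>j. if j = i then 1 else 0) = f i"
proof (rule synthesis_eqI)
  have "(\<Sum>j\<in>F. (if j = i then 1 else 0) *s f j) = f i" if "finite F" "{i} \<subseteq> F" for F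
  proof -
    have "(\<Sum>j\<in>F. (if j = i then 1 else 0) *s f j) = (\<Sum>j\<in>{i}. (if j = i then 1 else 0) *s f j)"
      using that by (intro sum.mono_neutral_right) auto
    thus ?thesis by simp
  qed
  hence "\<forall>\<^sub>F F in finite_subsets_at_top I. (\<Sum>j\<in>F. (if j = i then 1 else 0) *s f j) = f i"
    using assms unfolding eventually_finite_subsets_at_top by (intro exI[of _ "{i}"]) auto
  thus "limitin htopology (\<lambda>F. \<Sum>j\<in>F. (if j = i then 1 else 0) *s f j) (f i)
      (finite_subsets_at_top I)"
    unfolding htopology_eq hilbert.limitin_iff_ip_norm
    by (intro tendsto_eventually) (auto elim: eventually_mono)
qed

lemma unit_in_ell2: "i \<in> I \<Longrightarrow> (\<lambda>j. if j = i then 1 else 0) \<in> ell2 I"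
proof -
  assume "i \<in> I"
  have "(\<lambda>j. (cmod (if j = i then 1 else 0))\<^sup>2) = (\<lambda>j. if j \<in> {i} then 1 else 0)"
    by auto
  moreover have "(\<lambda>j. if j \<in> {i} then 1 else 0 :: real) summable_on I"
    using \<open>i \<in> I\<close> by (subst summable_on_if_mem_iff) auto
  ultimately show ?thesis
    using \<open>i \<in> I\<close> by (simp add: ell2_def)
qed

lemma summable_square_form: "(\<lambda>i. (cmod (form y (f i)))\<^sup>2) summable_on I"
proof -
  have "cmod (form y (f i)) = cmod (hinner (fundamental_symmetry y) (f i))" for i
    by (metis cmod_form_commute hilbert.cmod_form_commute form_eq_hinner_fundamental_symmetry)
  thus ?thesis
    using bessel by (auto simp: bessel_family_def)
qed

text \<open>Extending by \<open>0\<close> off \<open>J\<close> makes these coefficients an element of \<open>\<ell>\<^sub>2(I)\<close> fixed by the projection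
  onto \<open>\<ell>\<^sub>2(J)\<close>, so that the frame operator over \<open>J\<close> is a value of the one synthesis operator.\<close>

definition coefficients :: "'i set \<Rightarrow> 'a \<Rightarrow> 'i \<Rightarrow> complex" where
  "coefficients J y = (\<lambda>i. if i \<in> J then form y (f i) else 0)"

definition frame_operator :: "'i set \<Rightarrow> 'a \<Rightarrow> 'a" where
  "frame_operator J y = T (coefficients J y)"

lemma coefficients_in_ell2: "coefficients J y \<in> ell2 I" if "J \<subseteq> I"
proof -
  have "(\<lambda>i. if i \<in> J then (cmod (form y (f i)))\<^sup>2 else 0) summable_on I"
    using summable_on_subset_banach[OF summable_square_form[of y] that]
    by (simp add: summable_on_if_mem_iff[OF that])
  moreover have "(\<lambda>i. (cmod (coefficients J y i))\<^sup>2)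
      = (\<lambda>i. if i \<in> J then (cmod (form y (f i)))\<^sup>2 else 0)"
    by (auto simp: coefficients_def)
  ultimately show ?thesis
    using that by (auto simp: ell2_def coefficients_def)
qed

lemma form_frame_operator:
  assumes "J \<subseteq> I"
  shows "((\<lambda>i. form x (f i) * form (f i) y) has_sum form (frame_operator J x) y) J"
proof -
  have "(\<lambda>i. coefficients J x i * form (f i) y)
      = (\<lambda>i. if i \<in> J then form x (f i) * form (f i) y else 0)"
    by (auto simp: coefficients_def)
  thus ?thesis
    using form_synthesis[OF coefficients_in_ell2[OF assms], of x y]
    by (simp add: frame_operator_def has_sum_if_mem_iff[OF assms])
qed

lemma frame_operator_selfadjoint:
  assumes "J \<subseteq> I"
  shows "form (frame_operator J x) y = form x (frame_operator J y)"
proof -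
  have "((\<lambda>i. cnj (form y (f i) * form (f i) x)) has_sum cnj (form (frame_operator J y) x)) J"
    using form_frame_operator[OF assms] by (simp only: has_sum_cnj_iff)
  hence "((\<lambda>i. form x (f i) * form (f i) y) has_sum form x (frame_operator J y)) J"
    by (simp add: mult.commute flip: form_hermitian)
  thus ?thesis
    using form_frame_operator[OF assms] has_sum_unique by blast
qed

text \<open>The sum of the \<open>|[g, f\<^sub>i]|\<^sup>2\<close> is \<open>[S\<^sub>J g, g]\<close>, by the weak description of \<open>S\<^sub>J g\<close>. A negative \<open>\<alpha>\<close>
  occurs for the family over \<open>I\<^sub>-\<close>, whose Hilbert space carries \<open>-[\<cdot>,\<cdot>]\<close>.\<close>

lemma has_sum_square_form_iff:
  fixes \<alpha> :: real
  assumes "J \<subseteq> I"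
  shows "((\<lambda>i. (cmod (form g (f i)))\<^sup>2) has_sum (\<alpha> * Re (form g g))) J \<longleftrightarrow>
    form (frame_operator J g) g = of_real \<alpha> * form g g"
proof -
  have "form g (f i) * form (f i) g = of_real ((cmod (form g (f i)))\<^sup>2)" for i
    using form_hermitian[of "f i" g] by (simp only: complex_norm_square)
  hence sum: "((\<lambda>i. complex_of_real ((cmod (form g (f i)))\<^sup>2)) has_sum form (frame_operator J g) g) J"
    using form_frame_operator[OF assms, of g g] by simp
  have "((\<lambda>i. (cmod (form g (f i)))\<^sup>2) has_sum (\<alpha> * Re (form g g))) J \<longleftrightarrow>
      ((\<lambda>i. complex_of_real ((cmod (form g (f i)))\<^sup>2)) has_sum of_real (\<alpha> * Re (form g g))) J"
    by (simp only: has_sum_of_real_iff)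
  also have "\<dots> \<longleftrightarrow> form (frame_operator J g) g = of_real (\<alpha> * Re (form g g))"
    using sum has_sum_unique by metis
  also have "of_real (\<alpha> * Re (form g g)) = of_real \<alpha> * form g g"
    using form_self_real[of g] by simp
  finally show ?thesis .
qed

section \<open>Ranges of the synthesis operator and closed spans\<close>

lemma synthesis_image_subset_closure:
  assumes "J \<subseteq> I"
  shows "(T \<circ> ell2_proj J) ` ell2 I \<subseteq> htopology closure_of span (f ` J)"
proof clarsimp
  fix x assume "x \<in> ell2 I"
  hence "ell2_proj J x \<in> ell2 I"
    using assms by (rule ell2_proj_in_ell2)
  from synthesis_limit[OF this]
  show "T (ell2_proj J x) \<in> htopology closure_of span (f ` J)"
    unfolding htopology_eq
  proof (rule hilbert.limitin_imp_closure_of)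
    show "(\<Sum>i\<in>F. ell2_proj J x i *s f i) \<in> span (f ` J)" for F
      by (intro span_sum) (auto simp: ell2_proj_def intro: span_scale span_base span_zero)
  qed simp
qed

text \<open>The range contains each \<open>f\<^sub>i\<close> as the image of a unit vector. That it is a subspace is part of
  uniform definiteness in the application.\<close>

lemma span_subset_synthesis_image:
  assumes "J \<subseteq> I" "subspace ((T \<circ> ell2_proj J) ` ell2 I)"
  shows "span (f ` J) \<subseteq> (T \<circ> ell2_proj J) ` ell2 I"
proof (rule span_minimal[OF _ assms(2)], rule image_subsetI)
  fix i assume "i \<in> J"
  define e where "e = (\<lambda>j. if j = i then 1 else 0 :: complex)"
  have "ell2_proj J e = e"
    using \<open>i \<in> J\<close> by (auto simp: ell2_proj_def e_def)
  moreover have "e \<in> ell2 I" "T e = f i"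
    unfolding e_def using unit_in_ell2 synthesis_unit \<open>i \<in> J\<close> assms(1) by auto
  ultimately show "f i \<in> (T \<circ> ell2_proj J) ` ell2 I"
    by (intro image_eqI[of _ _ e]) auto
qed

lemma frame_operator_in_synthesis_image:
  assumes "J \<subseteq> I"
  shows "frame_operator J y \<in> (T \<circ> ell2_proj J) ` ell2 I"
proof (rule image_eqI)
  show "frame_operator J y = (T \<circ> ell2_proj J) (coefficients J y)"
    by (auto simp: frame_operator_def coefficients_def ell2_proj_def fun_eq_iff
        intro!: arg_cong[where f = T])
qed (rule coefficients_in_ell2[OF assms])

text \<open>Both sides are continuous in the norm. The factor \<open>s = \<plusminus>1\<close> covers the positive and
  the negative case together.\<close>

lemma closure_uniformly_definite:
  assumes "\<And>x. x \<in> S \<Longrightarrow> \<alpha> * (hnorm x)\<^sup>2 \<le> s * Re (form x x)" "x \<in> htopology closure_of S"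
  shows "\<alpha> * (hnorm x)\<^sup>2 \<le> s * Re (form x x)"
proof -
  obtain \<sigma> where \<sigma>: "\<And>n. \<sigma> n \<in> S" and lim: "limitin htopology \<sigma> x sequentially"
    using assms(2) unfolding htopology_eq by (rule hilbert.closure_of_sequentially) blast
  have "(\<lambda>n. hnorm (\<sigma> n)) \<longlonglongrightarrow> hnorm x"
    using lim unfolding htopology_eq hnorm_eq by (rule hilbert.tendsto_ip_norm)
  hence left: "(\<lambda>n. \<alpha> * (hnorm (\<sigma> n))\<^sup>2) \<longlonglongrightarrow> \<alpha> * (hnorm x)\<^sup>2"
    by (intro tendsto_intros)
  have right: "(\<lambda>n. s * Re (form (\<sigma> n) (\<sigma> n))) \<longlonglongrightarrow> s * Re (form x x)"
    by (intro tendsto_intros tendsto_form_self[OF lim])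
  show ?thesis
    using LIMSEQ_le[OF left right] assms(1) \<sigma> by blast
qed

lemma closure_span_uniformly_definite:
  assumes "J \<subseteq> I" "subspace ((T \<circ> ell2_proj J) ` ell2 I)"
    and definite: "\<forall>x\<in>(T \<circ> ell2_proj J) ` ell2 I. \<alpha> * (hnorm x)\<^sup>2 \<le> s * Re (form x x)"
  shows "subspace (htopology closure_of span (f ` J)) \<and>
    (\<forall>x\<in>htopology closure_of span (f ` J). \<alpha> * (hnorm x)\<^sup>2 \<le> s * Re (form x x))"
proof
  show "subspace (htopology closure_of span (f ` J))"
    unfolding htopology_eq by (rule hilbert.subspace_closure_of) simp
  show "\<forall>x\<in>htopology closure_of span (f ` J). \<alpha> * (hnorm x)\<^sup>2 \<le> s * Re (form x x)"
    using definite span_subset_synthesis_image[OF assms(1,2)]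
    by (blast intro: closure_uniformly_definite)
qed

lemma I_pos_subset: "I_pos I f \<subseteq> I" and I_neg_subset: "I_neg I f \<subseteq> I"
  by (auto simp: I_pos_def I_neg_def)

text \<open>The range lies between the span and its closure \<open>M\<^sub>+\<close>, which inherits uniform positivity; so
  maximality of the range forces equality.\<close>

lemma M_pos_eq_synthesis_image:
  assumes "max_unif_J_positive (synthesis_pos I f ` ell2 I)"
  shows "M_pos I f = synthesis_pos I f ` ell2 I"
proof -
  let ?R = "synthesis_pos I f ` ell2 I"
  obtain \<alpha> where "\<alpha> > 0" "subspace ?R" "\<forall>x\<in>?R. \<alpha> * (hnorm x)\<^sup>2 \<le> 1 * Re (form x x)"
    using assms by (auto simp: max_unif_J_positive_def unif_J_positive_def)
  hence "unif_J_positive (M_pos I f)"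
    using closure_span_uniformly_definite[OF I_pos_subset, of \<alpha> 1]
    by (auto simp: unif_J_positive_def M_pos_def synthesis_pos_def)
  moreover have "?R \<subseteq> M_pos I f"
    using synthesis_image_subset_closure[OF I_pos_subset] by (simp add: synthesis_pos_def M_pos_def)
  ultimately show ?thesis
    using assms by (auto simp: max_unif_J_positive_def)
qed

lemma M_neg_eq_synthesis_image:
  assumes "max_unif_J_negative (synthesis_neg I f ` ell2 I)"
  shows "M_neg I f = synthesis_neg I f ` ell2 I"
proof -
  let ?R = "synthesis_neg I f ` ell2 I"
  obtain \<alpha> where "\<alpha> > 0" "subspace ?R" "\<forall>x\<in>?R. \<alpha> * (hnorm x)\<^sup>2 \<le> (- 1) * Re (form x x)"
    using assms by (auto simp: max_unif_J_negative_def unif_J_negative_def)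
  hence "unif_J_negative (M_neg I f)"
    using closure_span_uniformly_definite[OF I_neg_subset, of \<alpha> "- 1"]
    by (auto simp: unif_J_negative_def M_neg_def synthesis_neg_def)
  moreover have "?R \<subseteq> M_neg I f"
    using synthesis_image_subset_closure[OF I_neg_subset] by (simp add: synthesis_neg_def M_neg_def)
  ultimately show ?thesis
    using assms by (auto simp: max_unif_J_negative_def)
qed

section \<open>Adjoint of the synthesis operator and tightness\<close>

lemma ell2_form_unit:
  assumes "i \<in> I"
  shows "ell2_form I f (\<lambda>j. if j = i then 1 else 0) z
    = (if i \<in> I_pos I f then cnj (z i) else - cnj (z i))"
proof -
  have "(\<Sum>\<^sub>\<infinity>j\<in>A. (if j = i then 1 else 0) * cnj (z j)) = (if i \<in> A then cnj (z i) else 0)" for A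
    by (rule infsumI, rule has_sum_finite_neutralI[of "A \<inter> {i}"]) auto
  thus ?thesis
    using assms by (auto simp: ell2_form_def I_pos_def I_neg_def)
qed

text \<open>The sign in front of the sum over \<open>I\<^sub>-\<close> in the form of \<open>\<ell>\<^sub>2(I)\<close> becomes the sign of the coordinates
  of \<open>T\<^sup>+ y\<close> over \<open>I\<^sub>-\<close>. Testing against unit vectors shows that no other vector
  represents \<open>x \<mapsto> [T x, y]\<close>.\<close>

lemma synthesis_adjoint_eq:
  "synthesis_adjoint I f y = (\<lambda>i. coefficients (I_pos I f) y i - coefficients (I_neg I f) y i)"
    (is "_ = ?z")
  unfolding synthesis_adjoint_def krein_adjoint_def
proof (rule the_equality)
  have "(\<lambda>i. (cmod (?z i))\<^sup>2) = (\<lambda>i. (cmod (coefficients I y i))\<^sup>2)"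
    by (auto simp: coefficients_def I_pos_def I_neg_def fun_eq_iff)
  hence z: "?z \<in> ell2 I"
    using coefficients_in_ell2[of I y] I_pos_subset I_neg_subset
    by (auto simp: ell2_def coefficients_def)
  have "form (T x) y = ell2_form I f x ?z" if x: "x \<in> ell2 I" for x
  proof -
    let ?g = "\<lambda>i. x i * form (f i) y"
    have sum: "(?g has_sum form (T x) y) I"
      by (rule form_synthesis[OF x])
    have "(?g has_sum infsum ?g (I_pos I f)) (I_pos I f)"
      "(?g has_sum infsum ?g (I_neg I f)) (I_neg I f)"
      using sum summable_on_subset_banach I_pos_subset I_neg_subset
      by (meson has_sum_infsum summable_on_def)+
    hence "(?g has_sum (infsum ?g (I_pos I f) + infsum ?g (I_neg I f))) (I_pos I f \<union> I_neg I f)"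
      by (rule has_sum_Un_disjoint) (auto simp: I_pos_def I_neg_def)
    moreover have "I_pos I f \<union> I_neg I f = I"
      by (auto simp: I_pos_def I_neg_def)
    ultimately have "form (T x) y = infsum ?g (I_pos I f) + infsum ?g (I_neg I f)"
      using sum has_sum_unique by fastforce
    moreover have "infsum ?g (I_pos I f) = (\<Sum>\<^sub>\<infinity>i\<in>I_pos I f. x i * cnj (?z i))"
      by (intro infsum_cong) (auto simp: coefficients_def I_pos_def I_neg_def simp flip: form_hermitian)
    moreover have "- infsum ?g (I_neg I f) = (\<Sum>\<^sub>\<infinity>i\<in>I_neg I f. x i * cnj (?z i))"
      unfolding infsum_uminus[symmetric]
      by (intro infsum_cong) (auto simp: coefficients_def I_pos_def I_neg_def simp flip: form_hermitian)
    ultimately show ?thesis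
      unfolding ell2_form_def by (metis diff_minus_eq_add)
  qed
  with z show *: "?z \<in> ell2 I \<and> (\<forall>x\<in>ell2 I. form (T x) y = ell2_form I f x ?z)"
    by blast
  fix z assume z': "z \<in> ell2 I \<and> (\<forall>x\<in>ell2 I. form (T x) y = ell2_form I f x z)"
  show "z = ?z"
  proof
    fix i
    show "z i = ?z i"
    proof (cases "i \<in> I")
      case True
      let ?e = "\<lambda>j. if j = i then 1 else 0"
      have "ell2_form I f ?e z = form (T ?e) y"
        by (rule z'[THEN conjunct2, rule_format, symmetric], rule unit_in_ell2[OF True])
      also have "\<dots> = ell2_form I f ?e ?z"
        by (rule *[THEN conjunct2, rule_format], rule unit_in_ell2[OF True])
      finally show ?thesis
        unfolding ell2_form_unit[OF True] by (simp split: if_splits del: complex_cnj_diff)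
    next
      case False
      thus ?thesis
        using z' I_pos_subset I_neg_subset by (auto simp: ell2_def coefficients_def)
    qed
  qed
qed

lemma synthesis_adjoint_composition:
  "T (synthesis_adjoint I f y)
    = frame_operator (I_pos I f) y + - frame_operator (I_neg I f) y"
proof (rule synthesis_eqI)
  let ?s = "\<lambda>J F. \<Sum>i\<in>F. coefficients J y i *s f i"
  have "limitin htopology (?s J) (frame_operator J y) (finite_subsets_at_top I)" if "J \<subseteq> I" for J
    unfolding frame_operator_def by (rule synthesis_limit[OF coefficients_in_ell2[OF that]])
  hence "limitin htopology (\<lambda>F. ?s (I_pos I f) F + - ?s (I_neg I f) F)
      (frame_operator (I_pos I f) y + - frame_operator (I_neg I f) y) (finite_subsets_at_top I)"
    using I_pos_subset I_neg_subset unfolding htopology_eq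
    by (intro hilbert.limitin_add hilbert.limitin_minus) auto
  thus "limitin htopology (\<lambda>F. \<Sum>i\<in>F. synthesis_adjoint I f y i *s f i)
      (frame_operator (I_pos I f) y + - frame_operator (I_neg I f) y) (finite_subsets_at_top I)"
    by (simp add: synthesis_adjoint_eq scale_left_diff_distrib sum_subtractf)
qed

lemma hnorm_pos: "x \<noteq> 0 \<Longrightarrow> 0 < hnorm x"
  by (simp add: hnorm_eq less_le)

text \<open>For each \<open>\<alpha> > 0\<close> the algebraic core applies to \<open>P\<close> and \<open>Q\<close>, the summands of \<open>T T\<^sup>+\<close>. The
  constant \<open>\<alpha>\<close> is the same on both sides of the equivalence.\<close>

theorem tight_J_frame_iff:
  assumes "J_frame I f"
  shows "tight_J_frame I f \<longleftrightarrow>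
    (\<exists>\<alpha>. tight_frame_on (M_pos I f) form (I_pos I f) f \<alpha> \<and>
         tight_frame_on (M_neg I f) neg_form (I_neg I f) f \<alpha>) \<and>
    M_neg I f = orth_companion (M_pos I f)"
proof -
  let ?P = "frame_operator (I_pos I f)" and ?N = "frame_operator (I_neg I f)"
  have max: "max_unif_J_positive (synthesis_pos I f ` ell2 I)"
    "max_unif_J_negative (synthesis_neg I f ` ell2 I)"
    using assms by (auto simp: J_frame_def)
  note M_pos = M_pos_eq_synthesis_image[OF max(1)] and M_neg = M_neg_eq_synthesis_image[OF max(2)]
  obtain a where pos: "subspace (M_pos I f)" "a > 0"
    "\<And>x. x \<in> M_pos I f \<Longrightarrow> a * (hnorm x)\<^sup>2 \<le> Re (form x x)"
    using max(1) by (auto simp: M_pos max_unif_J_positive_def unif_J_positive_def)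
  obtain b where neg: "subspace (M_neg I f)" "b > 0"
    "\<And>x. x \<in> M_neg I f \<Longrightarrow> b * (hnorm x)\<^sup>2 \<le> - Re (form x x)"
    using max(2) by (auto simp: M_neg max_unif_J_negative_def unif_J_negative_def)
  have core: "(\<forall>y. ?P y + - ?N y = of_real \<alpha> *s y) \<longleftrightarrow>
    (\<forall>g\<in>M_pos I f. form (?P g) g = of_real \<alpha> * form g g) \<and>
    (\<forall>g\<in>M_neg I f. form (- ?N g) g = of_real \<alpha> * form g g) \<and>
    M_neg I f = orth_companion (M_pos I f)" if "\<alpha> > 0" for \<alpha> :: real
  proof (rule sum_eq_scalar_iff_orthogonal[OF _ pos(1) neg(1)])
    show "\<alpha> \<noteq> 0"
      using that by simp
    show "0 < Re (form x x)" if "x \<in> M_pos I f" "x \<noteq> 0" for x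
      using pos(3)[OF that(1)] hnorm_pos[OF that(2)] \<open>a > 0\<close>
      by (intro less_le_trans[OF _ pos(3)[OF that(1)]]) simp
    show "Re (form x x) < 0" if "x \<in> M_neg I f" "x \<noteq> 0" for x
    proof -
      have "0 < b * (hnorm x)\<^sup>2"
        using hnorm_pos[OF that(2)] \<open>b > 0\<close> by simp
      thus ?thesis
        using neg(3)[OF that(1)] by simp
    qed
    show "?P y \<in> M_pos I f" for y
      unfolding M_pos synthesis_pos_def by (rule frame_operator_in_synthesis_image[OF I_pos_subset])
    show "- ?N y \<in> M_neg I f" for y
      using frame_operator_in_synthesis_image[OF I_neg_subset] subspace_neg[OF neg(1)]
      by (simp add: M_neg synthesis_neg_def)
    show "form (?P x) y = form x (?P y)" for x y
      by (rule frame_operator_selfadjoint[OF I_pos_subset])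
    show "form (- ?N x) y = form x (- ?N y)" for x y
      using frame_operator_selfadjoint[OF I_neg_subset]
      by (simp add: form_minus_left form_minus_right)
  qed
  have tight_pos: "tight_frame_on (M_pos I f) form (I_pos I f) f \<alpha> \<longleftrightarrow>
      \<alpha> > 0 \<and> (\<forall>g\<in>M_pos I f. form (?P g) g = of_real \<alpha> * form g g)" for \<alpha>
    by (simp add: tight_frame_on_def has_sum_square_form_iff[OF I_pos_subset])
  have tight_neg: "tight_frame_on (M_neg I f) neg_form (I_neg I f) f \<alpha> \<longleftrightarrow>
      \<alpha> > 0 \<and> (\<forall>g\<in>M_neg I f. form (- ?N g) g = of_real \<alpha> * form g g)" for \<alpha>
  proof -
    have "form (- ?N g) g = of_real \<alpha> * form g g \<longleftrightarrow> form (?N g) g = of_real (- \<alpha>) * form g g" for g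
      by (simp add: form_minus_left) (metis add.inverse_inverse)
    thus ?thesis
      using has_sum_square_form_iff[OF I_neg_subset, of _ "- \<alpha>"]
      by (simp add: tight_frame_on_def del: of_real_minus)
  qed
  show ?thesis
    unfolding tight_J_frame_def synthesis_adjoint_composition tight_pos tight_neg
    using assms core by blast
qed

end

theorem proposition5p2:
  fixes scale :: "complex \<Rightarrow> 'a::ab_group_add \<Rightarrow> 'a"
    and form :: "'a \<Rightarrow> 'a \<Rightarrow> complex"
    and Hp Hm :: "'a set"
    and I :: "'i set"
    and f :: "'i \<Rightarrow> 'a"
  defines "Mp \<equiv> decomposed_krein_space.M_pos scale form Hp Hm I f"
    and "Mm \<equiv> decomposed_krein_space.M_neg scale form Hp Hm I f"
  assumes "decomposed_krein_space scale form Hp Hm"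
    and "decomposed_krein_space.J_frame scale form Hp Hm I f"
  shows "decomposed_krein_space.tight_J_frame scale form Hp Hm I f \<longleftrightarrow>
    (\<exists>\<alpha>. tight_frame_on Mp form (decomposed_krein_space.I_pos form I f) f \<alpha> \<and>
         tight_frame_on Mm (\<lambda>x y. - form x y) (decomposed_krein_space.I_neg form I f) f \<alpha>) \<and>
    Mm = hermitian_space.orth_companion form Mp"
proof -
  interpret decomposed_krein_space scale form Hp Hm
    by fact
  interpret bessel_family_in_krein_space scale form Hp Hm I f
    using assms(4) by unfold_locales (simp add: J_frame_def)
  show ?thesis
    unfolding Mp_def Mm_def using assms(4) by (rule tight_J_frame_iff)
qed

end
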